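(* Let $l,m,n$ be integers with $0<l<m<n$, and let $B\subset\mathbb{R}^n$ be an analytic set. For $V\in G(n-l,m-l)$ write $\mathbb{V}=V\times\mathbb{R}^l\subset\mathbb{R}^n$ and $B_{\mathbb{V}}=\pi_{\mathbb{V}}(B)$, where $\pi_{\mathbb{V}}\colon\mathbb{R}^n\to\mathbb{V}$ is the orthogonal projection. Set $$\mathfrak{m}_{\mathrm{H}}:=\sup\{\dim_{\mathrm{H}}B_{\mathbb{V}} : V\in G(n-l,m-l)\}.$$ Then $\dim_{\mathrm{H}}B_{\mathbb{V}}=\mathfrak{m}_{\mathrm{H}}$ for $\gamma_{n-l,m-l}$ almost every $V\in G(n-l,m-l)$.
   Context: $G(d,k)$ is the Grassmannian of $k$-dimensional linear subspaces of $\mathbb{R}^d$, and $\gamma_{d,k}$ is the natural $O(d)$-invariant Borel probability measure on it. $\mathbb{R}^n$ is identified with $\mathbb{R}^{n-l}\times\mathbb{R}^l$, and $V\in G(n-l,m-l)$ is a subspace of $\mathbb{R}^{n-l}$, so $\mathbb{V}=V\times\mathbb{R}^l$ is an $m$-dimensional subspace of $\mathbb{R}^n$ containing $\{0\}\times\mathbb{R}^l$. $\dim_{\mathrm{H}}$ denotes Hausdorff dimension. *)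

theory Defs
  imports "HOL-Probability.Probability"
begin

subsection \<open>Analytic sets\<close>

definition analytic_set :: "'a::topological_space set \<Rightarrow> bool"
  where "analytic_set A \<longleftrightarrow>
    A = {} \<or> (\<exists>f :: (nat \<Rightarrow> nat) \<Rightarrow> 'a. continuous_on UNIV f \<and> A = range f)"

subsection \<open>Hausdorff measure and dimension\<close>

text \<open>The \<open>s\<close>-th power of the diameter with the usual conventions for \<open>s = 0\<close>
  (in the library, \<open>0 powr 0 = 0\<close>).\<close>

definition diam_power :: "real \<Rightarrow> 'a::metric_space set \<Rightarrow> ennreal"
  where "diam_power s U =
    (if U = {} then 0 else if s = 0 then 1 else ennreal (diameter U powr s))"

text \<open>The coverings are required to be bounded because \<^const>\<open>diameter\<close> is real-valued
  and meaningless on unbounded sets.\<close>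

definition hausdorff_premeasure :: "real \<Rightarrow> real \<Rightarrow> 'a::metric_space set \<Rightarrow> ennreal"
  where "hausdorff_premeasure s \<delta> A =
    (INF U \<in> {U :: nat \<Rightarrow> 'a set. A \<subseteq> (\<Union>i. U i) \<and> (\<forall>i. bounded (U i) \<and> diameter (U i) \<le> \<delta>)}.
       \<Sum>i. diam_power s (U i))"

definition hausdorff_measure :: "real \<Rightarrow> 'a::metric_space set \<Rightarrow> ennreal"
  where "hausdorff_measure s A = (SUP \<delta> \<in> {0<..}. hausdorff_premeasure s \<delta> A)"

definition hausdorff_dim :: "'a::metric_space set \<Rightarrow> ennreal"
  where "hausdorff_dim A = (INF s \<in> {s. 0 \<le> s \<and> hausdorff_measure s A = 0}. ennreal s)"

subsection \<open>Orthogonal projections\<close>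

definition orth_proj :: "'a::euclidean_space set \<Rightarrow> 'a \<Rightarrow> 'a"
  where "orth_proj V x = (THE y. y \<in> V \<and> (\<forall>v\<in>V. orthogonal (x - y) v))"

lemma orth_proj_ex1:
  fixes V :: "'a::euclidean_space set"
  assumes "subspace V"
  shows "\<exists>!y. y \<in> V \<and> (\<forall>v\<in>V. orthogonal (x - y) v)"
proof -
  obtain y z where yz: "y \<in> span V" "\<And>w. w \<in> span V \<Longrightarrow> orthogonal z w" "x = y + z"
    using orthogonal_subspace_decomp_exists by blast
  have sp: "span V = V" using assms by (simp add: span_eq_iff)
  show ?thesis
  proof (rule ex1I[of _ y])
    show "y \<in> V \<and> (\<forall>v\<in>V. orthogonal (x - y) v)" using yz sp by simp
  next
    fix y' assume y': "y' \<in> V \<and> (\<forall>v\<in>V. orthogonal (x - y') v)"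
    have d: "y' - y \<in> V" using y' yz(1) sp assms by (simp add: subspace_diff)
    have "(x - y) \<bullet> (y' - y) = 0" "(x - y') \<bullet> (y' - y) = 0"
      using y' yz sp d by (auto simp: orthogonal_def)
    then have "(y' - y) \<bullet> (y' - y) = 0"
      by (simp add: inner_diff_left)
    then show "y' = y" by simp
  qed
qed

lemma orth_proj:
  fixes V :: "'a::euclidean_space set"
  assumes "subspace V"
  shows orth_proj_mem: "orth_proj V x \<in> V"
    and orth_proj_orthogonal: "v \<in> V \<Longrightarrow> orthogonal (x - orth_proj V x) v"
  using theI'[OF orth_proj_ex1[OF assms, of x]] unfolding orth_proj_def by auto

lemma orth_proj_unique:
  fixes V :: "'a::euclidean_space set"
  assumes "subspace V" "y \<in> V" "\<And>v. v \<in> V \<Longrightarrow> orthogonal (x - y) v"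
  shows "orth_proj V x = y"
  unfolding orth_proj_def
  by (rule the1_equality[OF orth_proj_ex1[OF assms(1)]]) (use assms in auto)

lemma orth_proj_self:
  assumes "subspace V" "x \<in> V" shows "orth_proj V x = x"
  using assms by (intro orth_proj_unique) (auto simp: orthogonal_def)

lemma linear_orth_proj:
  fixes V :: "'a::euclidean_space set"
  assumes "subspace V"
  shows "linear (orth_proj V)"
proof (rule linearI)
  fix x y :: 'a
  show "orth_proj V (x + y) = orth_proj V x + orth_proj V y"
  proof (rule orth_proj_unique[OF assms])
    show "orth_proj V x + orth_proj V y \<in> V"
      by (simp add: assms orth_proj_mem subspace_add)
    fix v assume "v \<in> V"
    from orth_proj_orthogonal[OF assms this, of x] orth_proj_orthogonal[OF assms this, of y]
    show "orthogonal (x + y - (orth_proj V x + orth_proj V y)) v"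
      by (simp add: orthogonal_def inner_diff_left inner_add_left)
  qed
next
  fix r :: real and x :: 'a
  show "orth_proj V (r *\<^sub>R x) = r *\<^sub>R orth_proj V x"
  proof (rule orth_proj_unique[OF assms])
    show "r *\<^sub>R orth_proj V x \<in> V"
      by (simp add: assms orth_proj_mem subspace_scale)
    fix v assume "v \<in> V"
    from orth_proj_orthogonal[OF assms this, of x]
    show "orthogonal (r *\<^sub>R x - r *\<^sub>R orth_proj V x) v"
      by (simp add: orthogonal_def inner_diff_left)
  qed
qed

subsection \<open>The Grassmannian and its invariant measure\<close>

text \<open>For \<open>'a = real ^ 'd\<close> with \<open>CARD('d) = d\<close>, this is \<open>G(d,k)\<close>.\<close>

definition grassmannian :: "nat \<Rightarrow> 'a::euclidean_space set set"
  where "grassmannian k = {V. subspace V \<and> dim V = k}"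

text \<open>The operator norm of the difference of the orthogonal projections. The value off subspaces
  is irrelevant; it makes the total function nonnegative, as required by \<^locale>\<open>Metric_space\<close>.\<close>

definition grassmann_dist :: "'a::euclidean_space set \<Rightarrow> 'a set \<Rightarrow> real"
  where "grassmann_dist V W =
    (if subspace V \<and> subspace W then onorm (\<lambda>x. orth_proj V x - orth_proj W x) else 0)"

lemma bounded_linear_orth_proj_diff:
  fixes V W :: "'a::euclidean_space set"
  assumes "subspace V" "subspace W"
  shows "bounded_linear (\<lambda>x. orth_proj V x - orth_proj W x)"
  by (intro bounded_linear_sub linear_linear[THEN iffD2] linear_orth_proj assms)

lemma Metric_space_grassmannian:
  "Metric_space (grassmannian k :: 'a::euclidean_space set set) grassmann_dist"
proof
  fix V W :: "'a set"
  show "0 \<le> grassmann_dist V W"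
    by (auto simp: grassmann_dist_def intro!: onorm_pos_le bounded_linear_orth_proj_diff)
  show "grassmann_dist V W = grassmann_dist W V"
    unfolding grassmann_dist_def
    using onorm_neg[of "\<lambda>x. orth_proj V x - orth_proj W x"] by (simp add: conj_commute)
next
  fix V W :: "'a set"
  assume "V \<in> grassmannian k" "W \<in> grassmannian k"
  then have s: "subspace V" "subspace W" by (auto simp: grassmannian_def)
  show "grassmann_dist V W = 0 \<longleftrightarrow> V = W"
  proof
    assume "grassmann_dist V W = 0"
    then have eq: "orth_proj V x = orth_proj W x" for x
      using s onorm_eq_0[OF bounded_linear_orth_proj_diff[OF s]] by (simp add: grassmann_dist_def)
    show "V = W"
    proof (intro equalityI subsetI)
      fix x assume "x \<in> V"
      then show "x \<in> W"
        using orth_proj_self[OF s(1), of x] orth_proj_mem[OF s(2), of x] eq[of x] by simp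
    next
      fix x assume "x \<in> W"
      then show "x \<in> V"
        using orth_proj_self[OF s(2), of x] orth_proj_mem[OF s(1), of x] eq[of x] by simp
    qed
  qed (simp add: grassmann_dist_def s onorm_zero)
next
  fix U V W :: "'a set"
  assume "U \<in> grassmannian k" "V \<in> grassmannian k" "W \<in> grassmannian k"
  then have s: "subspace U" "subspace V" "subspace W" by (auto simp: grassmannian_def)
  show "grassmann_dist U W \<le> grassmann_dist U V + grassmann_dist V W"
    using onorm_triangle[OF bounded_linear_orth_proj_diff[OF s(1,2)]
        bounded_linear_orth_proj_diff[OF s(2,3)]] s
    by (simp add: grassmann_dist_def)
qed

definition grassmann_topology :: "nat \<Rightarrow> 'a::euclidean_space set topology"
  where "grassmann_topology k = Metric_space.mtopology (grassmannian k) grassmann_dist"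

text \<open>The characterization of \<open>\<gamma>\<^bsub>d,k\<^esub>\<close>: an \<open>O(d)\<close>-invariant Borel probability measure on the
  Grassmannian, where \<open>O(d)\<close> acts by \<open>V \<mapsto> g(V)\<close>. By transitivity of the action of the compact
  group \<open>O(d)\<close>, there is exactly one such measure for \<open>k \<le> d\<close>.\<close>

definition is_grassmann_measure :: "nat \<Rightarrow> 'a::euclidean_space set measure \<Rightarrow> bool"
  where "is_grassmann_measure k \<gamma> \<longleftrightarrow>
    prob_space \<gamma> \<and>
    space \<gamma> = grassmannian k \<and>
    sets \<gamma> = sigma_sets (grassmannian k) {U. openin (grassmann_topology k) U} \<and>
    (\<forall>g :: 'a \<Rightarrow> 'a. orthogonal_transformation g \<longrightarrow>
      (\<forall>A \<in> sets \<gamma>. emeasure \<gamma> ((\<lambda>V. g ` V) ` A) = emeasure \<gamma> A))"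

subsection \<open>Projections to \<open>V \<times> \<real>\<^sup>l\<close>\<close>

definition proj_image :: "('a::euclidean_space \<times> 'b::euclidean_space) set \<Rightarrow> 'a set \<Rightarrow> ('a \<times> 'b) set"
  where "proj_image B V = orth_proj (V \<times> UNIV) ` B"

end

(*
  Let k = m - l. Fix W in G(n-l,k) and 0 < tau < s < dim pi_W(B), where pi_V is the projection onto
  V x R^l. Dyadic cubes of W x R^l carry an s-dimensional net content, which is positive on pi_W(B).
  This content is continuous along increasing sequences, hence (B being analytic) it stays bounded
  below on a decreasing sequence of sets shrinking to a compact subset of B, and on the n-th of these
  a discrete Frostman argument gives a finitely supported probability mu_n such that pi_W(mu_n) has
  mass at most C 2^(-js) on each cube of side 2^(-j), j <= n.

  For z = (u,v) the event |pi_V(z)| <= 2^(-j) requires |v| <= 2^(-j) and |P_V u| <= 2^(-j), and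
  the latter has probability at most C 2^(-ik) if |u| is about 2^(i-j). On the other hand the z'
  whose difference with a fixed point has |u| <= 2^(i-j), |v| <= 2^(-j) are projected by pi_W into
  C 2^(ik) cubes of side 2^(-j). The two factors cancel, so the expected mu_n-measure of the points
  z' with |pi_V(z - z')| <= 2^(-j) is at most C j 2^(-js). By Fatou's lemma, for almost every V the
  tau-energies of pi_V(mu_n) truncated at scale 2^(-n) are bounded along a subsequence, and the mass
  distribution principle gives dim pi_V(B) >= tau.
*)

theory Submission
  imports Defs
begin

section \<open>Contents on refining partitions\<close>

text \<open>The common value is not a function of the dimension of B: with n - l = 2 and k = l = 1,
  both R^2 x {0} and (a line) x R have dimension 2, but their suprema are 1 and 2. An ordinary
  Frostman measure on B is therefore too weak, and mass is controlled on cylinders over cells of W x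
  R^l instead. The exponents cancel because V and W have the same dimension k. One bounded term
  remains for each of the roughly j dyadic sizes of u, and tau < s absorbs the factor j. The weights
  depend on W only, so their energies can be integrated over V. Net contents are used because cells
  are nested or disjoint: continuity along increasing sequences becomes a counting argument, and a
  minimal cut of the tree certifies the mass of the Frostman weights. No limit measure is formed.
  The support of mu_n lies in a truncation that only shrinks to the compact set, which is enough
  because an open set containing the compact set already contains some truncation. Every cover is
  tested against a single large n, so the subsequence may depend on V.\<close>

locale refining_partitions =
  fixes c :: "nat \<Rightarrow> 'z \<Rightarrow> 'c" and w :: real
  assumes refine: "i \<le> j \<Longrightarrow> c j x = c j y \<Longrightarrow> c i x = c i y"
    and w_pos: "0 < w"
begin

definition covers :: "(nat \<times> 'c) set \<Rightarrow> 'z set \<Rightarrow> bool"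
  where "covers D A \<longleftrightarrow> (\<forall>z\<in>A. \<exists>j. (j, c j z) \<in> D)"

text \<open>A level j cell costs w^j, the s-th power of its side when w = 2^-s. Making the cost a
  measure on the set of cells gives additivity and continuity from below at once.\<close>

definition cost_measure :: "(nat \<times> 'c) measure"
  where "cost_measure = density (count_space UNIV) (\<lambda>q. ennreal (w ^ fst q))"

abbreviation "cost \<equiv> emeasure cost_measure"

text \<open>A cover may mix all levels, as for Hausdorff content; there is no fineness parameter.
  Only the vanishing of this quantity is later compared with Hausdorff measure.\<close>

definition cell_content :: "'z set \<Rightarrow> ennreal"
  where "cell_content A = (INF D \<in> {D. covers D A}. cost D)"

lemma sets_cost_measure [simp, measurable]: "sets cost_measure = UNIV"
  by (simp add: cost_measure_def)

lemma cost_eq: "cost D = (\<integral>\<^sup>+q. ennreal (w ^ fst q) \<partial>count_space D)"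
  by (simp add: cost_measure_def emeasure_density nn_integral_count_space_indicator)

lemma cost_mono: "D \<subseteq> D' \<Longrightarrow> cost D \<le> cost D'"
  by (intro emeasure_mono) auto

lemma cost_singleton: "cost {q} = ennreal (w ^ fst q)"
  by (simp add: cost_eq nn_integral_count_space_finite)

lemma cell_content_le: "covers D A \<Longrightarrow> cell_content A \<le> cost D"
  unfolding cell_content_def by (rule INF_lower) simp

lemma cell_content_mono: "A \<subseteq> A' \<Longrightarrow> cell_content A \<le> cell_content A'"
  unfolding cell_content_def by (rule INF_superset_mono) (auto simp: covers_def)

lemma cell_content_empty: "cell_content {} = 0"
  using cell_content_le[of "{}" "{}"] by (simp add: covers_def)

lemma cell_content_less_imp_cover:
  assumes "cell_content A < e" obtains D where "covers D A" "cost D < e"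
  using assms unfolding cell_content_def INF_less_iff by auto

text \<open>Restricted to \<open>D\<close>, the cost is a finite measure that charges every single
  cell, and a finite measure has only countably many point masses.\<close>

lemma countable_cost_finite:
  assumes "cost D < \<infinity>" shows "countable D"
proof -
  have em: "emeasure (restrict_space cost_measure D) X = cost X" if "X \<subseteq> D" for X
    using that by (intro emeasure_restrict_space) (auto simp: cost_measure_def)
  interpret D: finite_measure "restrict_space cost_measure D"
    using assms em[of D] by (intro finite_measureI) (auto simp: space_restrict_space cost_measure_def)
  have "measure (restrict_space cost_measure D) {q} \<noteq> 0" if "q \<in> D" for q
    using em[of "{q}"] that w_pos by (auto simp: measure_def cost_singleton)
  then have "D \<subseteq> {q. measure (restrict_space cost_measure D) {q} \<noteq> 0}" by auto
  then show ?thesis using D.countable_support countable_subset by blast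
qed

text \<open>Maximal for inclusion: coarser levels are larger cells. By \<open>refine\<close>, all
  points \<open>z\<close> of a cell lie in the same cell of level \<open>i\<close>, so quantifying
  over \<open>z\<close> merely names that cell.\<close>

definition maximal_cells :: "(nat \<times> 'c) set \<Rightarrow> (nat \<times> 'c) set"
  where "maximal_cells D = {(j, a) \<in> D. \<forall>i<j. \<forall>z. c j z = a \<longrightarrow> (i, c i z) \<notin> D}"

lemma maximal_cells_subset: "maximal_cells D \<subseteq> D"
  by (auto simp: maximal_cells_def)

lemma maximal_cells_antimono:
  "D \<subseteq> D' \<Longrightarrow> q \<in> maximal_cells D' \<Longrightarrow> q \<in> D \<Longrightarrow> q \<in> maximal_cells D"
  by (auto simp: maximal_cells_def)

lemma maximal_cells_memI:
  assumes "(i, c i z) \<in> D"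
  obtains j where "j \<le> i" "(j, c j z) \<in> maximal_cells D"
proof -
  define j where "j = (LEAST j. (j, c j z) \<in> D)"
  have j: "(j, c j z) \<in> D" "j \<le> i"
    unfolding j_def using assms LeastI[of "\<lambda>j. (j, c j z) \<in> D"] Least_le[of "\<lambda>j. (j, c j z) \<in> D"] by auto
  have "(i', c i' z') \<notin> D" if "i' < j" "c j z' = c j z" for i' z'
    using refine[of i' j z' z] that not_less_Least[of i' "\<lambda>j. (j, c j z) \<in> D"] by (auto simp: j_def)
  with j show ?thesis using that by (auto simp: maximal_cells_def)
qed

lemma maximal_cells_covers:
  assumes "covers D A" shows "covers (maximal_cells D) A"
  using assms maximal_cells_memI unfolding covers_def by metis

text \<open>Strong subadditivity: where \<open>D\<close> and \<open>D'\<close> both cover a point, the smaller of the two nested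
  cells is not maximal, so the cells left over by \<open>maximal_cells\<close> (counted with multiplicity)
  still cover \<open>A\<close>.\<close>

lemma cost_maximal_cells_Un:
  assumes "covers D A" "covers D' A"
  shows "cost (maximal_cells (D \<union> D')) + cell_content A \<le> cost (maximal_cells D) + cost D'"
proof -
  define M where "M = maximal_cells (D \<union> D')"
  define E where "E = maximal_cells D"
  define R where "R = (E \<union> D' - M) \<union> (E \<inter> D')"
  have ME: "M \<subseteq> E \<union> D'"
    using maximal_cells_subset[of "D \<union> D'"] maximal_cells_antimono[of D "D \<union> D'"]
    by (auto simp: M_def E_def)
  have "covers R A"
    unfolding covers_def
  proof
    fix z assume z: "z \<in> A"
    obtain i where i: "(i, c i z) \<in> E"
      using maximal_cells_covers[OF assms(1)] z by (auto simp: E_def covers_def)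
    obtain j where j: "(j, c j z) \<in> D'" using assms(2) z by (auto simp: covers_def)
    have iD: "(i, c i z) \<in> D" using i maximal_cells_subset by (auto simp: E_def)
    consider "i = j" | "i < j" | "j < i" by linarith
    then show "\<exists>j. (j, c j z) \<in> R"
    proof cases
      case 1 then show ?thesis using i j by (auto simp: R_def)
    next
      case 2
      then have "(j, c j z) \<notin> M" using iD by (auto simp: M_def maximal_cells_def)
      then show ?thesis using j by (auto simp: R_def)
    next
      case 3
      then have "(i, c i z) \<notin> M" using j by (auto simp: M_def maximal_cells_def)
      then show ?thesis using i by (auto simp: R_def)
    qed
  qed
  then have "cost M + cell_content A \<le> cost M + cost R"
    by (intro add_left_mono cell_content_le)
  also have "\<dots> = (cost M + cost (E \<union> D' - M)) + cost (E \<inter> D' \<inter> M)"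
  proof -
    \<comment> \<open>The cells of \<open>E \<inter> D'\<close> outside \<open>M\<close> already
      occur in the first part of \<open>R\<close>; adding only those in \<open>M\<close> makes the
      union disjoint.\<close>
    have "cost R = cost ((E \<union> D' - M) \<union> (E \<inter> D' \<inter> M))"
      by (rule arg_cong[where f=cost]) (auto simp: R_def)
    also have "\<dots> = cost (E \<union> D' - M) + cost (E \<inter> D' \<inter> M)"
      by (rule plus_emeasure[symmetric]) auto
    finally show ?thesis by (simp add: add.assoc)
  qed
  also have "cost M + cost (E \<union> D' - M) = cost (E \<union> D')"
    using ME by (subst plus_emeasure) (auto intro!: arg_cong[where f=cost])
  also have "cost (E \<union> D') + cost (E \<inter> D' \<inter> M) \<le> cost (E \<union> D') + cost (E \<inter> D')"
    by (intro add_left_mono cost_mono) auto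
  also have "\<dots> = cost (D' \<union> (E - D')) + cost (E \<inter> D')"
    by (simp add: Un_commute)
  also have "cost (D' \<union> (E - D')) = cost D' + cost (E - D')"
    by (rule plus_emeasure[symmetric]) auto
  also have "cost D' + cost (E - D') + cost (E \<inter> D') = cost D' + cost ((E - D') \<union> (E \<inter> D'))"
    by (subst plus_emeasure[symmetric, of "E - D'"]) (auto simp: add.assoc)
  also have "(E - D') \<union> (E \<inter> D') = E" by auto
  finally show ?thesis by (simp add: M_def E_def add.commute)
qed

text \<open>Near-optimal covers of the sets \<open>A i\<close> are merged one after the other,
  retaining maximal cells only. Strong subadditivity keeps the cost of the merged cover near the
  content of the current set, with summable errors.\<close>

lemma cell_content_incseq:
  assumes inc: "incseq A" and K: "\<And>i. cell_content (A i) \<le> K"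
  shows "cell_content (\<Union>i. A i) \<le> K"
proof (cases "K = \<infinity>")
  case False
  have fin: "cell_content (A i) < \<infinity>" for i
    using K[of i] False by (simp add: less_top[symmetric] top_unique neq_top_trans)
  show ?thesis
  proof (rule ennreal_le_epsilon)
    fix e :: real assume e: "0 < e"
    define \<epsilon> where "\<epsilon> i = ennreal (e * (1/2) ^ Suc i)" for i :: nat
    have "\<exists>D. covers D (A i) \<and> cost D \<le> cell_content (A i) + \<epsilon> i" for i
    proof -
      have "cell_content (A i) < cell_content (A i) + \<epsilon> i"
        using fin[of i] e by (simp add: \<epsilon>_def ennreal_add_left_cancel_less[of _ 0, simplified])
      then show ?thesis by (metis cell_content_less_imp_cover order_less_imp_le)
    qed
    then obtain C where C: "\<And>i. covers (C i) (A i)" "\<And>i. cost (C i) \<le> cell_content (A i) + \<epsilon> i"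
      by metis
    define U where "U n = (\<Union>i\<le>n. C i)" for n
    have bound: "cost (maximal_cells (U n)) \<le> cell_content (A n) + (\<Sum>i\<le>n. \<epsilon> i)" for n
    proof (induction n)
      case 0
      show ?case using C(2)[of 0] cost_mono[OF maximal_cells_subset, of "C 0"]
        by (auto simp: U_def intro: order_trans)
    next
      case (Suc n)
      \<comment> \<open>\<open>A n\<close> is covered twice, by the merged cover and by the new one.
        Strong subadditivity refunds its content once, so each step adds only the error of the new
        cover.\<close>
      have cov: "covers (U n) (A n)" "covers (C (Suc n)) (A n)"
        using C(1)[of n] C(1)[of "Suc n"] incseq_SucD[OF inc, of n]
        by (auto simp: covers_def U_def) blast+
      have "cost (maximal_cells (U (Suc n))) + cell_content (A n)
          \<le> cost (maximal_cells (U n)) + cost (C (Suc n))"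
        using cost_maximal_cells_Un[OF cov] by (simp add: U_def atMost_Suc Un_commute)
      also have "\<dots> \<le> (cell_content (A n) + (\<Sum>i\<le>n. \<epsilon> i)) + (cell_content (A (Suc n)) + \<epsilon> (Suc n))"
        by (intro add_mono Suc C)
      also have "\<dots> = (cell_content (A (Suc n)) + (\<Sum>i\<le>Suc n. \<epsilon> i)) + cell_content (A n)"
        by (simp add: ac_simps)
      finally show ?case using fin[of n]
        by (auto simp: ennreal_add_left_cancel_le add.commute[of _ "cell_content (A n)"])
    qed
    define M where "M = maximal_cells (\<Union>n. U n)"
    have "covers (\<Union>n. U n) (\<Union>i. A i)"
      unfolding covers_def
    proof
      fix z assume "z \<in> (\<Union>i. A i)"
      then obtain i where "z \<in> A i" by auto
      then obtain j where "(j, c j z) \<in> C i" using C(1)[of i] by (auto simp: covers_def)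
      then show "\<exists>j. (j, c j z) \<in> (\<Union>n. U n)" by (auto simp: U_def)
    qed
    then have "cell_content (\<Union>i. A i) \<le> cost M"
      unfolding M_def by (intro cell_content_le maximal_cells_covers)
    \<comment> \<open>A cell that is maximal in the whole union is maximal in each
      \<open>U n\<close> containing it. Hence \<open>M\<close> is an increasing union of pieces
      whose costs obey \<open>bound\<close>.\<close>
    also have "M = (\<Union>n. M \<inter> U n)"
      using maximal_cells_subset by (fastforce simp: M_def)
    also have "cost (\<Union>n. M \<inter> U n) = (SUP n. cost (M \<inter> U n))"
      by (rule SUP_emeasure_incseq[symmetric])
        (auto simp: incseq_def U_def intro: order_trans)
    also have "\<dots> \<le> K + ennreal e"
    proof (rule SUP_least)
      fix n
      have "cost (M \<inter> U n) \<le> cost (maximal_cells (U n))"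
        using maximal_cells_antimono[of "U n" "\<Union>n. U n"]
        by (intro cost_mono) (auto simp: M_def)
      also have "\<dots> \<le> cell_content (A n) + (\<Sum>i\<le>n. \<epsilon> i)" by (rule bound)
      also have "(\<Sum>i\<le>n. \<epsilon> i) \<le> ennreal e"
      proof -
        have "(\<Sum>i\<le>n. (1/2::real) ^ Suc i) \<le> 1"
          using sum_le_suminf[OF sums_summable[OF power_half_series], of "{..n}"]
            sums_unique[OF power_half_series] by simp
        then have "e * (\<Sum>i\<le>n. (1/2::real) ^ Suc i) \<le> e"
          using e mult_left_le by force
        then show ?thesis unfolding \<epsilon>_def
          using e by (subst sum_ennreal) (auto simp: sum_distrib_left intro!: ennreal_leI)
      qed
      finally show "cost (M \<inter> U n) \<le> K + ennreal e"
        using K[of n] by (meson add_mono order_trans order_refl)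
    qed
    finally show "cell_content (\<Union>i. A i) \<le> K + ennreal e" .
  qed
qed simp

end

section \<open>Discrete Frostman weights and truncation of the parameter space\<close>

context refining_partitions begin

text \<open>A discrete form of Frostman's lemma on the tree of cells of the levels \<open>j, \<dots>, n\<close>: weights on
  \<open>Y\<close> giving mass at most \<open>w ^ i\<close> to each cell of level \<open>i\<close>, and a cover (the minimal cut) which
  certifies that their total mass is large.\<close>

definition frostman_system ::
    "nat \<Rightarrow> nat \<Rightarrow> 'z set \<Rightarrow> 'z set \<Rightarrow> ('z \<Rightarrow> real) \<Rightarrow> (nat \<times> 'c) set \<Rightarrow> bool"
  where "frostman_system j n Y S p D \<longleftrightarrow> finite S \<and> S \<subseteq> Y \<and> (\<forall>z\<in>S. 0 \<le> p z) \<and>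
    (\<forall>i a. j \<le> i \<and> i \<le> n \<longrightarrow> (\<Sum>z\<in>{z\<in>S. c i z = a}. p z) \<le> w ^ i) \<and>
    covers D Y \<and> cost D \<le> ennreal (\<Sum>z\<in>S. p z)"

definition frostman :: "nat \<Rightarrow> nat \<Rightarrow> 'z set \<Rightarrow> bool"
  where "frostman j n Y \<longleftrightarrow> (\<exists>S p D. frostman_system j n Y S p D)"

lemma frostmanI:
  assumes "finite S" "S \<subseteq> Y" "\<And>z. z \<in> S \<Longrightarrow> 0 \<le> p z"
    "\<And>i a. j \<le> i \<Longrightarrow> i \<le> n \<Longrightarrow> (\<Sum>z\<in>{z\<in>S. c i z = a}. p z) \<le> w ^ i"
    "covers D Y" "cost D \<le> ennreal (\<Sum>z\<in>S. p z)"
  shows "frostman j n Y"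
proof -
  have "frostman_system j n Y S p D"
    unfolding frostman_system_def by (intro conjI allI ballI impI assms) auto
  then show ?thesis unfolding frostman_def by blast
qed

text \<open>Different cells of level \<open>j\<close> do not interact: by \<open>refine\<close>, a
  cell of level \<open>i \<ge> j\<close> meets only one of the pieces, so its mass bound involves
  the weights of that piece alone.\<close>

lemma frostman_glue:
  assumes fin: "finite (c j ` Y)"
    and cells: "\<And>a. a \<in> c j ` Y \<Longrightarrow> frostman j n {z\<in>Y. c j z = a}"
  shows "frostman j n Y"
proof -
  obtain S p D where sys: "\<And>a. a \<in> c j ` Y \<Longrightarrow>
      frostman_system j n {z\<in>Y. c j z = a} (S a) (p a) (D a)"
    using cells unfolding frostman_def by metis
  have H: "finite (S a)" "S a \<subseteq> {z\<in>Y. c j z = a}" "\<And>z. z \<in> S a \<Longrightarrow> 0 \<le> p a z"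
      "\<And>i b. j \<le> i \<Longrightarrow> i \<le> n \<Longrightarrow> (\<Sum>z\<in>{z\<in>S a. c i z = b}. p a z) \<le> w ^ i"
      "covers (D a) {z\<in>Y. c j z = a}" "cost (D a) \<le> ennreal (\<Sum>z\<in>S a. p a z)"
    if "a \<in> c j ` Y" for a
    using sys[OF that] by (auto simp: frostman_system_def)
  define T where "T = (\<Union>a\<in>c j ` Y. S a)"
  define q where "q z = p (c j z) z" for z
  define E where "E = (\<Union>a\<in>c j ` Y. D a)"
  have cj: "c j z = a \<and> z \<in> Y" if "z \<in> S a" "a \<in> c j ` Y" for z a using H(2)[OF that(2)] that(1) by auto
  have fT: "finite T" "T \<subseteq> Y"
    unfolding T_def using H(1) fin cj by blast+
  have q0: "0 \<le> q z" if "z \<in> T" for z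
  proof -
    obtain a where a: "z \<in> S a" "a \<in> c j ` Y" using \<open>z \<in> T\<close> unfolding T_def by blast
    then show ?thesis using cj[OF a] H(3)[OF a(2)] by (simp add: q_def)
  qed
  have mass: "(\<Sum>z\<in>{z\<in>T. c i z = b}. q z) \<le> w ^ i" if i: "j \<le> i" "i \<le> n" for i b
  proof (cases "{z\<in>T. c i z = b} = {}")
    case True
    then have "(\<Sum>z\<in>{z\<in>T. c i z = b}. q z) = 0" by (simp only: sum.empty)
    then show ?thesis using w_pos by simp
  next
    case False
    then obtain a y where y: "y \<in> S a" "c i y = b" "a \<in> c j ` Y" by (auto simp: T_def)
    have "{z\<in>T. c i z = b} = {z\<in>S a. c i z = b}"
    proof (intro set_eqI iffI; clarsimp)
      fix z assume z: "z \<in> T" "b = c i z"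
      then obtain a' where a': "z \<in> S a'" "a' \<in> c j ` Y" by (auto simp: T_def)
      have "c j z = c j y" using refine[of j i z y] i z y by auto
      then show "z \<in> S a" using cj a' y by metis
    qed (use y in \<open>auto simp: T_def\<close>)
    moreover have "(\<Sum>z\<in>{z\<in>S a. c i z = b}. q z) = (\<Sum>z\<in>{z\<in>S a. c i z = b}. p a z)"
      using cj[OF _ y(3)] by (intro sum.cong) (auto simp: q_def)
    ultimately show ?thesis using H(4)[OF y(3) i] by simp
  qed
  have cov: "covers E Y"
  proof -
    have "\<exists>i. (i, c i z) \<in> E" if z: "z \<in> Y" for z
    proof -
      have "c j z \<in> c j ` Y" using z by auto
      with H(5)[OF this] z show ?thesis unfolding covers_def E_def by blast
    qed
    then show ?thesis by (auto simp: covers_def)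
  qed
  have cost: "cost E \<le> ennreal (\<Sum>z\<in>T. q z)"
  proof -
    have "cost E \<le> (\<Sum>a\<in>c j ` Y. cost (D a))"
      unfolding E_def by (rule emeasure_subadditive_finite) (auto simp: fin)
    also have "\<dots> \<le> (\<Sum>a\<in>c j ` Y. ennreal (\<Sum>z\<in>S a. p a z))"
      by (intro sum_mono H(6))
    also have "\<dots> = ennreal (\<Sum>a\<in>c j ` Y. \<Sum>z\<in>S a. p a z)"
      by (intro sum_ennreal sum_nonneg H(3))
    also have "(\<Sum>a\<in>c j ` Y. \<Sum>z\<in>S a. p a z) = (\<Sum>a\<in>c j ` Y. \<Sum>z\<in>S a. q z)"
    proof (intro sum.cong refl)
      fix a z assume "a \<in> c j ` Y" "z \<in> S a"
      then show "p a z = q z" using cj[of z a] by (simp add: q_def)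
    qed
    also have "\<dots> = (\<Sum>z\<in>T. q z)"
      unfolding T_def
    proof (rule sum.UNION_disjoint[symmetric])
      show "\<forall>a\<in>c j ` Y. \<forall>b\<in>c j ` Y. a \<noteq> b \<longrightarrow> S a \<inter> S b = {}"
        by (metis cj disjoint_iff)
    qed (use fin H(1) in auto)
    finally show ?thesis .
  qed
  show ?thesis by (rule frostmanI[OF fT q0 mass cov cost])
qed

text \<open>The only new constraint is that of the single cell \<open>a\<close> of level
  \<open>j\<close>. If the mass exceeds \<open>w ^ j\<close>, it is scaled down to exactly this
  value, and the cell \<open>a\<close> itself becomes the certifying cover; otherwise the old cover
  still certifies.\<close>

lemma frostman_step:
  assumes Y: "\<And>z. z \<in> Y \<Longrightarrow> c j z = a" and "frostman (Suc j) n Y"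
  shows "frostman j n Y"
proof -
  obtain S p D where H: "finite S" "S \<subseteq> Y" "\<forall>z\<in>S. 0 \<le> p z"
    "\<And>i b. Suc j \<le> i \<Longrightarrow> i \<le> n \<Longrightarrow> (\<Sum>z\<in>{z\<in>S. c i z = b}. p z) \<le> w ^ i"
    "covers D Y" "cost D \<le> ennreal (\<Sum>z\<in>S. p z)"
  proof -
    obtain S p D where "frostman_system (Suc j) n Y S p D"
      using assms(2) by (auto simp: frostman_def)
    then show thesis by (intro that[of S p D]) (auto simp: frostman_system_def)
  qed
  define t where "t = (\<Sum>z\<in>S. p z)"
  have t0: "0 \<le> t" using H by (auto simp: t_def intro: sum_nonneg)
  have mono: "(\<Sum>z\<in>{z\<in>S. c i z = b}. p z) \<le> t" for i b
    unfolding t_def using H by (intro sum_mono2) auto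
  show ?thesis
  proof (cases "t \<le> w ^ j")
    case True
    have "(\<Sum>z\<in>{z\<in>S. c i z = b}. p z) \<le> w ^ i" if "j \<le> i" "i \<le> n" for i b
      using that H(4)[of i b] mono[of i b] True by (cases "i = j") auto
    then show ?thesis by (intro frostmanI[of S Y p j n D]) (use H in auto)
  next
    case False
    define r where "r = w ^ j / t"
    have t: "0 < t" using False w_pos zero_less_power[of w j] by linarith
    have r: "0 \<le> r" "r \<le> 1" "r * t = w ^ j" using False t w_pos by (auto simp: r_def)
    have "(\<Sum>z\<in>{z\<in>S. c i z = b}. r * p z) \<le> w ^ i" if "j \<le> i" "i \<le> n" for i b
    proof (cases "i = j")
      case True
      then show ?thesis
        using mult_left_mono[OF mono[of i b] r(1)] r(3) by (simp add: sum_distrib_left)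
    next
      case False
      have "r * (\<Sum>z\<in>{z\<in>S. c i z = b}. p z) \<le> 1 * (\<Sum>z\<in>{z\<in>S. c i z = b}. p z)"
        using H(3) r by (intro mult_right_mono) (auto intro!: sum_nonneg)
      then show ?thesis using H(4)[of i b] that False by (simp add: sum_distrib_left)
    qed
    moreover have "covers {(j, a)} Y" using Y by (auto simp: covers_def)
    moreover have "cost {(j, a)} \<le> ennreal (\<Sum>z\<in>S. r * p z)"
      using r(3) by (simp add: cost_singleton t_def sum_distrib_left)
    ultimately show ?thesis
      using H r by (intro frostmanI[of S Y "\<lambda>z. r * p z" j n "{(j, a)}"]) auto
  qed
qed

lemma frostman_leaf:
  assumes Y: "\<And>z. z \<in> Y \<Longrightarrow> c n z = a" and "Y \<noteq> {}"
  shows "frostman n n Y"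
proof -
  obtain y where "y \<in> Y" using assms by auto
  moreover have "(\<Sum>z\<in>{z\<in>{y}. c n z = b}. w ^ n) \<le> w ^ n" for b
  proof (cases "c n y = b")
    case True
    then have "{z\<in>{y}. c n z = b} = {y}" by auto
    then show ?thesis by simp
  next
    case False
    then have empty: "{z\<in>{y}. c n z = b} = {}" by auto
    show ?thesis unfolding empty using w_pos by simp
  qed
  ultimately show ?thesis using w_pos Y
    by (intro frostmanI[of "{y}" Y "\<lambda>_. w ^ n" n n "{(n, a)}"])
      (auto simp: covers_def cost_singleton dest!: le_antisym)
qed

lemma frostman_finite:
  assumes "\<And>i. i \<le> n \<Longrightarrow> finite (c i ` Y)" and "j \<le> n"
  shows "frostman j n Y"
  using \<open>j \<le> n\<close> assms(1)
proof (induction arbitrary: Y rule: inc_induct)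
  case base
  show ?case
    by (rule frostman_glue) (auto intro!: frostman_leaf base)
next
  case (step j)
  show ?case
  proof (rule frostman_glue)
    fix a
    have "finite (c i ` {z\<in>Y. c j z = a})" if "i \<le> n" for i
      by (rule finite_subset[OF _ step.prems[OF that]]) auto
    then have "frostman (Suc j) n {z\<in>Y. c j z = a}" by (rule step.IH)
    then show "frostman j n {z\<in>Y. c j z = a}" by (rule frostman_step[rotated]) auto
  qed (use step in auto)
qed

text \<open>The certifying cover costs at least the content of \<open>Y\<close>, so the total mass
  exceeds \<kappa>. Normalising it to 1 therefore loses at most the factor 1/\<kappa>.\<close>

lemma exists_frostman_weights:
  assumes "\<And>i. i \<le> n \<Longrightarrow> finite (c i ` Y)" and \<kappa>: "0 < \<kappa>" "ennreal \<kappa> < cell_content Y"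
  obtains S p where "finite S" "S \<subseteq> Y" "\<And>z. z \<in> S \<Longrightarrow> 0 \<le> p z" "(\<Sum>z\<in>S. p z) = 1"
    "\<And>i a. i \<le> n \<Longrightarrow> (\<Sum>z\<in>{z\<in>S. c i z = a}. p z) \<le> w ^ i / \<kappa>"
proof -
  obtain S p D where H: "finite S" "S \<subseteq> Y" "\<And>z. z\<in>S \<Longrightarrow> 0 \<le> p z"
    "\<And>i b. i \<le> n \<Longrightarrow> (\<Sum>z\<in>{z\<in>S. c i z = b}. p z) \<le> w ^ i"
    "covers D Y" "cost D \<le> ennreal (\<Sum>z\<in>S. p z)"
  proof -
    obtain S p D where "frostman_system 0 n Y S p D"
      using frostman_finite[of n Y 0, OF assms(1)] by (auto simp: frostman_def)
    then show thesis by (intro that[of S p D]) (auto simp: frostman_system_def)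
  qed
  define t where "t = (\<Sum>z\<in>S. p z)"
  have "ennreal \<kappa> < ennreal t"
    using \<kappa>(2) cell_content_le[OF H(5)] H(6) by (auto simp: t_def)
  then have t: "\<kappa> < t" using \<kappa>(1) by (simp add: ennreal_less_iff)
  show thesis
  proof (rule that[of S "\<lambda>z. p z / t"])
    fix i a assume "i \<le> n"
    then have "(\<Sum>z\<in>{z\<in>S. c i z = a}. p z) / t \<le> w ^ i / \<kappa>"
      using H(4)[of i a] t \<kappa>(1) w_pos by (intro frac_le) auto
    then show "(\<Sum>z\<in>{z\<in>S. c i z = a}. p z / t) \<le> w ^ i / \<kappa>"
      by (simp add: sum_divide_distrib)
  qed (use H t \<kappa>(1) in \<open>auto simp: t_def simp flip: sum_divide_distrib\<close>)
qed

text \<open>This replaces an inner compact set of the analytic set: the points \<open>x\<close> with \<open>x i \<le> \<nu> i\<close> for all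
  \<open>i\<close> form a compact set, but only its finite truncations are known to have large content.\<close>

lemma cell_content_compact_truncation:
  fixes f :: "(nat \<Rightarrow> nat) \<Rightarrow> 'z"
  assumes "K < cell_content (f ` X)"
  obtains \<nu> :: "nat \<Rightarrow> nat" where "\<And>j. K < cell_content (f ` {x\<in>X. \<forall>i<j. x i \<le> \<nu> i})"
proof -
  \<comment> \<open>Coordinates are bounded one at a time: \<open>P\<close> reads \<nu> only below
    \<open>r\<close>, as the recursive choice of \<open>\<nu> r\<close> requires.\<close>
  define P where "P \<nu> r y \<longleftrightarrow> K < cell_content (f ` {x\<in>X. (\<forall>i<r. x i \<le> \<nu> i) \<and> x r \<le> y})"
    for \<nu> :: "nat \<Rightarrow> nat" and r y :: nat
  have "\<exists>\<nu>. \<forall>r. P \<nu> r (\<nu> r)"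
  proof (rule dependent_wellorder_choice)
    fix r and \<nu> \<nu>' :: "nat \<Rightarrow> nat" and y assume "\<And>i. i < r \<Longrightarrow> \<nu> i = \<nu>' i"
    then have "{x\<in>X. (\<forall>i<r. x i \<le> \<nu> i) \<and> x r \<le> y} = {x\<in>X. (\<forall>i<r. x i \<le> \<nu>' i) \<and> x r \<le> y}"
      by auto
    then show "P \<nu> r y = P \<nu>' r y" unfolding P_def by (simp only:)
  next
    fix r and \<nu> :: "nat \<Rightarrow> nat" assume IH: "\<And>i. i < r \<Longrightarrow> P \<nu> i (\<nu> i)"
    define A where "A y = f ` {x\<in>X. (\<forall>i<r. x i \<le> \<nu> i) \<and> x r \<le> y}" for y
    have U: "(\<Union>y. A y) = f ` {x\<in>X. \<forall>i<r. x i \<le> \<nu> i}"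
      by (auto simp: A_def)
    have "K < cell_content (\<Union>y. A y)"
    proof (cases r)
      case 0 then show ?thesis using assms by (simp add: U)
    next
      case (Suc r')
      have "{x\<in>X. \<forall>i<r. x i \<le> \<nu> i} = {x\<in>X. (\<forall>i<r'. x i \<le> \<nu> i) \<and> x r' \<le> \<nu> r'}"
        by (auto simp: Suc less_Suc_eq)
      then show ?thesis using IH[of r'] unfolding U P_def by (simp add: Suc)
    qed
    \<comment> \<open>The sets \<open>A y\<close> increase to the previous truncation, so continuity
      of the content yields a bound for coordinate \<open>r\<close>.\<close>
    then have "\<not> (\<forall>y. cell_content (A y) \<le> K)"
      using cell_content_incseq[of A K] by (fastforce simp: incseq_def A_def)
    then show "\<exists>y. P \<nu> r y" by (auto simp: P_def A_def not_le)
  qed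
  then obtain \<nu> where \<nu>: "\<And>r. P \<nu> r (\<nu> r)" by blast
  have "K < cell_content (f ` {x\<in>X. \<forall>i<j. x i \<le> \<nu> i})" for j
  proof -
    have "{x\<in>X. (\<forall>i<j. x i \<le> \<nu> i) \<and> x j \<le> \<nu> j} \<subseteq> {x\<in>X. \<forall>i<j. x i \<le> \<nu> i}" by auto
    from cell_content_mono[OF image_mono[OF this, of f]] \<nu>[of j]
    show ?thesis unfolding P_def by (rule less_le_trans[rotated])
  qed
  then show thesis by (rule that)
qed

end

section \<open>Compact boxes in the Baire space\<close>

lemma compact_nat_box: "compact {x :: nat \<Rightarrow> nat. \<forall>i. x i \<le> \<nu> i}"
proof -
  have "{x. \<forall>i. x i \<le> \<nu> i} = PiE UNIV (\<lambda>i. {..\<nu> i})" by (auto simp: PiE_def Pi_def)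
  moreover have "compactin (product_topology (\<lambda>i. euclidean) UNIV) (PiE UNIV (\<lambda>i. {..\<nu> i}))"
    by (auto simp: compactin_PiE intro: finite_imp_compact)
  ultimately show ?thesis by (simp add: euclidean_product_topology)
qed

text \<open>Otherwise every truncation has a point outside \<open>G\<close>. Clipping these points
  into the compact box gives a convergent subsequence. In any fixed coordinate the clipping
  eventually changes nothing, so the unclipped points have the same limit, which lies in the open
  set \<open>G\<close>.\<close>

lemma truncation_subset_open:
  fixes G :: "(nat \<Rightarrow> nat) set" and \<nu> :: "nat \<Rightarrow> nat"
  assumes "open G" "{x. \<forall>i. x i \<le> \<nu> i} \<subseteq> G"
  obtains j where "{x. \<forall>i<j. x i \<le> \<nu> i} \<subseteq> G"
proof (rule ccontr)
  assume "\<not> thesis"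
  then have "\<forall>j. \<exists>x. (\<forall>i<j. x i \<le> \<nu> i) \<and> x \<notin> G" using that by auto
  then obtain x where x: "\<And>j i. i < j \<Longrightarrow> x j i \<le> \<nu> i" "\<And>j. x j \<notin> G" by metis
  define y where "y j i = min (x j i) (\<nu> i)" for j i
  have "seq_compact {x. \<forall>i. x i \<le> \<nu> i}"
    using compact_nat_box by (rule compact_imp_seq_compact)
  moreover have "\<forall>j. y j \<in> {x. \<forall>i. x i \<le> \<nu> i}" by (auto simp: y_def)
  ultimately obtain l r where l: "l \<in> {x. \<forall>i. x i \<le> \<nu> i}" "strict_mono r" "(y \<circ> r) \<longlonglongrightarrow> l"
    by (rule seq_compactE)
  have "eventually (\<lambda>k. x (r k) \<in> G) sequentially"
  proof -
    have "(\<lambda>k. x (r k)) \<longlonglongrightarrow> l"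
    proof -
      have "limitin (product_topology (\<lambda>i. euclidean) UNIV) (\<lambda>k. x (r k)) l sequentially"
        unfolding limitin_componentwise
      proof (intro conjI ballI)
        fix i :: nat
        have "limitin (product_topology (\<lambda>i. euclidean) UNIV) (y \<circ> r) l sequentially"
          using l(3) by (simp add: euclidean_product_topology)
        then have "(\<lambda>k. y (r k) i) \<longlonglongrightarrow> l i"
          by (simp add: limitin_componentwise)
        moreover have "eventually (\<lambda>k. y (r k) i = x (r k) i) sequentially"
          using eventually_gt_at_top[of i]
        proof eventually_elim
          case (elim k)
          then have "i < r k" using seq_suble[OF l(2), of k] by simp
          then show ?case using x(1) by (simp add: y_def min_absorb1)
        qed
        ultimately show "limitin euclidean (\<lambda>k. x (r k) i) (l i) sequentially"
          by (simp add: tendsto_cong)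
      qed auto
      then show ?thesis by (simp add: euclidean_product_topology)
    qed
    then show ?thesis using assms l(1) topological_tendstoD by blast
  qed
  then show False using x by (auto simp: eventually_sequentially)
qed

section \<open>Grid cells of an orthonormal system\<close>

text \<open>For an orthonormal \<open>B\<close>, the cells are the preimages, under the projection
  onto the span of \<open>B\<close>, of half-open cubes of side 2^-j. Labels are restricted to
  \<open>B\<close> so that equal coordinates mean equal labels.\<close>

definition grid_cell :: "'e::real_inner set \<Rightarrow> nat \<Rightarrow> 'e \<Rightarrow> 'e \<Rightarrow> int"
  where "grid_cell B j z = (\<lambda>b\<in>B. \<lfloor>2 ^ j * (z \<bullet> b)\<rfloor>)"

lemma floor_dyadic_coarsen:
  fixes t :: real
  assumes "i \<le> j" shows "\<lfloor>2 ^ i * t\<rfloor> = \<lfloor>2 ^ j * t\<rfloor> div 2 ^ (j - i)"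
proof -
  have "\<lfloor>2 ^ j * t / real_of_int (2 ^ (j - i))\<rfloor> = \<lfloor>2 ^ j * t\<rfloor> div 2 ^ (j - i)"
    by (rule floor_divide_real_eq_div) simp
  moreover have "2 ^ j * t / real_of_int (2 ^ (j - i)) = 2 ^ i * t"
    using assms power_add[of "2::real" i "j - i"] by (simp add: field_simps)
  ultimately show ?thesis by simp
qed

lemma refining_partitions_grid_cell:
  assumes "0 < w" shows "refining_partitions (grid_cell B) w"
proof
  fix i j :: nat and x y :: 'a
  assume "i \<le> j" "grid_cell B j x = grid_cell B j y"
  then have "\<lfloor>2 ^ j * (x \<bullet> b)\<rfloor> = \<lfloor>2 ^ j * (y \<bullet> b)\<rfloor>" if "b \<in> B" for b
    using that by (auto simp: grid_cell_def dest: fun_cong[of _ _ b])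
  then show "grid_cell B i x = grid_cell B i y"
    using floor_dyadic_coarsen[OF \<open>i \<le> j\<close>] by (auto simp: grid_cell_def fun_eq_iff restrict_def)
qed fact

lemma grid_cell_eq_imp_close:
  assumes "grid_cell B j x = grid_cell B j y" "b \<in> B"
  shows "\<bar>(x - y) \<bullet> b\<bar> \<le> (1/2) ^ j"
proof -
  have "\<lfloor>2 ^ j * (x \<bullet> b)\<rfloor> = \<lfloor>2 ^ j * (y \<bullet> b)\<rfloor>"
    using assms by (auto simp: grid_cell_def dest: fun_cong[of _ _ b])
  then have "\<bar>2 ^ j * (x \<bullet> b) - 2 ^ j * (y \<bullet> b)\<bar> \<le> 1" by linarith
  then have "2 ^ j * \<bar>(x - y) \<bullet> b\<bar> \<le> 1"
    by (simp add: inner_diff_left abs_mult flip: right_diff_distrib)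
  then show ?thesis by (simp add: power_one_over field_simps)
qed

lemma grid_cell_close:
  assumes "\<bar>(x - y) \<bullet> b\<bar> \<le> r" "b \<in> B"
  shows "\<bar>grid_cell B j x b - grid_cell B j y b\<bar> \<le> \<lceil>2 ^ j * r\<rceil>"
proof -
  have "\<bar>2 ^ j * (x \<bullet> b) - 2 ^ j * (y \<bullet> b)\<bar> \<le> 2 ^ j * r"
    using assms(1) by (simp add: inner_diff_left abs_mult flip: right_diff_distrib)
  then show ?thesis using assms(2) by (auto simp: grid_cell_def) linarith+
qed

lemma grid_cells_near:
  fixes M :: "'e::real_inner \<Rightarrow> int"
  assumes "finite B" and "\<And>b. b \<in> B \<Longrightarrow> 0 \<le> M b"
    and near: "\<And>z b. z \<in> S \<Longrightarrow> b \<in> B \<Longrightarrow> \<bar>grid_cell B j z b - g b\<bar> \<le> M b"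
  shows "finite (grid_cell B j ` S)"
    and "real (card (grid_cell B j ` S)) \<le> (\<Prod>b\<in>B. 2 * real_of_int (M b) + 1)"
proof -
  let ?P = "PiE B (\<lambda>b. {g b - M b .. g b + M b})"
  have fin: "finite ?P" using assms by (intro finite_PiE) auto
  have "grid_cell B j z b \<in> {g b - M b .. g b + M b}" if "z \<in> S" "b \<in> B" for z b
    using near[OF that] by (simp add: abs_le_iff)
  then have sub: "grid_cell B j ` S \<subseteq> ?P"
    by (auto simp: grid_cell_def PiE_iff)
  then show "finite (grid_cell B j ` S)" using fin finite_subset by blast
  have "card (grid_cell B j ` S) \<le> card ?P" using sub fin by (rule card_mono[rotated])
  also have "card ?P = (\<Prod>b\<in>B. nat (2 * M b + 1))"
    using assms(1) by (subst card_PiE) (auto intro!: prod.cong)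
  finally have "real (card (grid_cell B j ` S)) \<le> real (\<Prod>b\<in>B. nat (2 * M b + 1))"
    by (rule of_nat_mono)
  also have "\<dots> = (\<Prod>b\<in>B. 2 * real_of_int (M b) + 1)"
    unfolding of_nat_prod using assms(2) by (intro prod.cong) auto
  finally show "real (card (grid_cell B j ` S)) \<le> (\<Prod>b\<in>B. 2 * real_of_int (M b) + 1)" .
qed

lemma finite_grid_cells_bounded:
  assumes "finite B" "bounded S"
  shows "finite (grid_cell B j ` S)"
proof -
  obtain R where R: "\<And>z. z \<in> S \<Longrightarrow> norm z \<le> R" using assms(2) by (auto simp: bounded_iff)
  show ?thesis
  proof (rule grid_cells_near(1)[where g="grid_cell B j 0" and M="\<lambda>b. \<lceil>2 ^ j * (\<bar>R\<bar> * norm b)\<rceil>"])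
    fix z b assume z: "z \<in> S" "b \<in> B"
    have "\<bar>(z - 0) \<bullet> b\<bar> \<le> \<bar>R\<bar> * norm b"
    proof -
      have "norm z \<le> \<bar>R\<bar>" using R[OF z(1)] by simp
      from mult_right_mono[OF this norm_ge_zero, of b] show ?thesis
        using Cauchy_Schwarz_ineq2[of z b] by simp
    qed
    then show "\<bar>grid_cell B j z b - grid_cell B j 0 b\<bar> \<le> \<lceil>2 ^ j * (\<bar>R\<bar> * norm b)\<rceil>"
      using z(2) by (rule grid_cell_close)
  next
    fix b
    have "0 \<le> 2 ^ j * (\<bar>R\<bar> * norm b)" by simp
    then show "0 \<le> \<lceil>2 ^ j * (\<bar>R\<bar> * norm b)\<rceil>" by linarith
  qed (use assms in auto)
qed

section \<open>Orthonormal bases and the link with Hausdorff measure\<close>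

definition orthonormal_basis :: "'e::euclidean_space set \<Rightarrow> 'e set \<Rightarrow> bool"
  where "orthonormal_basis B T \<longleftrightarrow>
    finite B \<and> pairwise orthogonal B \<and> (\<forall>b\<in>B. norm b = 1) \<and> span B = T"

lemma exists_orthonormal_basis:
  fixes T :: "'e::euclidean_space set"
  assumes "subspace T" obtains B where "orthonormal_basis B T" "card B = dim T"
proof -
  obtain B where "pairwise orthogonal B" "\<And>x. x \<in> B \<Longrightarrow> norm x = 1" "independent B"
    "card B = dim T" "span B = T"
    by (rule orthonormal_basis_subspace[OF assms]) metis
  then show thesis by (intro that[of B]) (auto simp: orthonormal_basis_def independent_imp_finite)
qed

lemma norm_le_sum_orthonormal_basis:
  assumes "orthonormal_basis B T" "x \<in> T"
  shows "norm x \<le> (\<Sum>b\<in>B. \<bar>x \<bullet> b\<bar>)"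
proof -
  have "norm x = norm (\<Sum>b\<in>B. (x \<bullet> b) *\<^sub>R b)"
    using assms by (subst orthonormal_basis_expand) (auto simp: orthonormal_basis_def)
  also have "\<dots> \<le> (\<Sum>b\<in>B. norm ((x \<bullet> b) *\<^sub>R b))" by (rule norm_sum)
  also have "\<dots> = (\<Sum>b\<in>B. \<bar>x \<bullet> b\<bar>)"
    using assms by (intro sum.cong) (auto simp: orthonormal_basis_def)
  finally show ?thesis .
qed

lemma orth_proj_inner:
  assumes "subspace V" "v \<in> V" shows "orth_proj V x \<bullet> v = x \<bullet> v"
  using orth_proj_orthogonal[OF assms, of x] unfolding orthogonal_def inner_diff_left by linarith

lemma norm_orth_proj_le_cell:
  assumes "orthonormal_basis B T" "grid_cell B j x = grid_cell B j y"
  shows "norm (orth_proj T x - orth_proj T y) \<le> real (card B) * (1/2) ^ j"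
proof -
  have T: "subspace T" and BT: "B \<subseteq> T"
    using assms(1) by (auto simp: orthonormal_basis_def span_base)
  have "norm (orth_proj T x - orth_proj T y)
      \<le> (\<Sum>b\<in>B. \<bar>(orth_proj T x - orth_proj T y) \<bullet> b\<bar>)"
    using T by (intro norm_le_sum_orthonormal_basis[OF assms(1)] subspace_diff orth_proj_mem)
  also have "\<dots> \<le> (\<Sum>b\<in>B. (1/2) ^ j)"
  proof (rule sum_mono)
    fix b assume "b \<in> B"
    then show "\<bar>(orth_proj T x - orth_proj T y) \<bullet> b\<bar> \<le> (1/2) ^ j"
      using grid_cell_eq_imp_close[OF assms(2)] T BT
      by (auto simp: inner_diff_left orth_proj_inner)
  qed
  finally show ?thesis by simp
qed

text \<open>A cover of small total cost consists of small cells, since the cost of each cell is the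
  s-th power of its side and s > 0. So vanishing content, which ignores sizes, still yields covers
  of arbitrarily small diameter.\<close>

lemma hausdorff_measure_eq_0I:
  fixes c :: "nat \<Rightarrow> 'z \<Rightarrow> 'c" and g :: "'z \<Rightarrow> 'm::metric_space"
  assumes s: "0 < s" and part: "refining_partitions c (2 powr -s)"
    and diam: "\<And>j x y. c j x = c j y \<Longrightarrow> dist (g x) (g y) \<le> N * (1/2) ^ j"
    and zero: "refining_partitions.cell_content c (2 powr -s) A = 0"
  shows "hausdorff_measure s (g ` A) = 0"
proof -
  interpret refining_partitions c "2 powr -s" by (rule part)
  have N: "0 \<le> N" using diam[of 0 undefined undefined] by simp
  have w: "(2 powr - s) ^ j = ((1/2) ^ j) powr s" for j :: nat
    by (simp add: powr_realpow[symmetric] powr_powr powr_minus_divide powr_divide mult.commute)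
  have *: "hausdorff_premeasure s \<delta> (g ` A) \<le> 0 + ennreal \<epsilon>" if \<delta>: "0 < \<delta>" and \<epsilon>: "0 < \<epsilon>" for \<delta> \<epsilon>
  proof -
    \<comment> \<open>The first bound controls the total s-th power of the diameters, the second
      forces every diameter below \<delta>. The added 1 avoids division by zero when
      \<open>N = 0\<close>.\<close>
    define e where "e = min (\<epsilon> / (N powr s + 1)) ((\<delta> / (N + 1)) powr s)"
    have e: "0 < e" using \<delta> \<epsilon> N by (auto simp: e_def add_nonneg_pos)
    obtain D where D: "covers D A" "cost D < ennreal e"
      using zero e by (elim cell_content_less_imp_cover[of A "ennreal e", rotated]) auto
    have "countable D" using D(2) by (intro countable_cost_finite) (auto simp: less_top[symmetric])
    then obtain h :: "nat \<times> 'c \<Rightarrow> nat" where h: "inj_on h D" by (auto simp: countable_def)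
    define X where "X q = g ` {z. c (fst q) z = snd q}" for q :: "nat \<times> 'c"
    define U where "U n = (if n \<in> h ` D then X (inv_into D h n) else {})" for n
    have Uh: "U (h q) = X q" if "q \<in> D" for q using that h by (auto simp: U_def)
    have bdd: "bounded (X q)" and dX: "diameter (X q) \<le> N * (1/2) ^ fst q" for q
    proof -
      have *: "dist x y \<le> N * (1/2) ^ fst q" if "x \<in> X q" "y \<in> X q" for x y
        using that diam by (auto simp: X_def)
      then show "bounded (X q)" by (auto simp: bounded_two_points)
      show "diameter (X q) \<le> N * (1/2) ^ fst q"
        using * N by (auto simp: diameter_def intro!: cSUP_least)
    qed
    have small: "N * (1/2) ^ fst q \<le> \<delta>" if "q \<in> D" for q
    proof -
      have "ennreal (((1/2) ^ fst q) powr s) \<le> cost D"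
        using that cost_mono[of "{q}" D] by (simp add: cost_singleton w)
      then have "ennreal (((1/2) ^ fst q) powr s) < ennreal e" using D(2) by simp
      then have "((1/2) ^ fst q) powr s < (\<delta> / (N + 1)) powr s"
        by (simp add: ennreal_less_iff e_def)
      then have "(1/2) ^ fst q < \<delta> / (N + 1)"
        using s \<delta> N powr_mono2[of s "\<delta> / (N + 1)" "(1/2) ^ fst q"] by (smt (verit) divide_nonneg_pos)
      then have "(N + 1) * (1/2) ^ fst q < \<delta>" using N by (simp add: field_simps)
      moreover have "N * (1/2) ^ fst q \<le> (N + 1) * (1/2) ^ fst q"
        by (intro mult_right_mono) auto
      ultimately show ?thesis by linarith
    qed
    have "g ` A \<subseteq> (\<Union>i. U i)"
    proof clarify
      fix z assume "z \<in> A"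
      then obtain j where j: "(j, c j z) \<in> D" using D(1) by (auto simp: covers_def)
      then have "g z \<in> U (h (j, c j z))" by (auto simp: Uh X_def)
      then show "g z \<in> (\<Union>i. U i)" by blast
    qed
    moreover have "bounded (U i) \<and> diameter (U i) \<le> \<delta>" for i
    proof (cases "i \<in> h ` D")
      case True
      then obtain q where "q \<in> D" "i = h q" by auto
      then show ?thesis using bdd[of q] dX[of q] small[of q] by (auto simp: Uh)
    qed (use \<delta> in \<open>auto simp: U_def diameter_def\<close>)
    ultimately have "hausdorff_premeasure s \<delta> (g ` A) \<le> (\<Sum>i. diam_power s (U i))"
      unfolding hausdorff_premeasure_def by (intro INF_lower) auto
    also have "\<dots> = (\<integral>\<^sup>+i. diam_power s (U i) \<partial>count_space UNIV)"
      by (rule nn_integral_count_space_nat[symmetric])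
    also have "\<dots> = (\<integral>\<^sup>+i. diam_power s (U i) \<partial>count_space (h ` D))"
      by (subst (2) nn_integral_count_space_indicator)
        (auto intro!: nn_integral_cong simp: U_def diam_power_def indicator_def)
    also have "\<dots> = (\<integral>\<^sup>+q. diam_power s (U (h q)) \<partial>count_space D)"
      using h by (intro nn_integral_bij_count_space[symmetric]) (auto simp: bij_betw_def)
    also have "\<dots> \<le> (\<integral>\<^sup>+q. ennreal (N powr s) * ennreal ((2 powr - s) ^ fst q) \<partial>count_space D)"
    proof (rule nn_integral_mono)
      fix q assume "q \<in> space (count_space D)"
      then have "U (h q) = X q" by (simp add: Uh)
      moreover have "diameter (X q) powr s \<le> (N * (1/2) ^ fst q) powr s"
        using s dX[of q] diameter_ge_0[OF bdd[of q]] by (intro powr_mono2) auto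
      ultimately show "diam_power s (U (h q)) \<le> ennreal (N powr s) * ennreal ((2 powr - s) ^ fst q)"
        using s N by (auto simp: diam_power_def w powr_mult simp flip: ennreal_mult intro!: ennreal_leI)
    qed
    also have "\<dots> = ennreal (N powr s) * cost D"
      by (simp add: cost_eq nn_integral_cmult)
    also have "\<dots> \<le> ennreal (N powr s) * ennreal e"
      using D(2) by (intro mult_left_mono) auto
    also have "\<dots> \<le> ennreal \<epsilon>"
    proof -
      have "N powr s * e \<le> (N powr s + 1) * (\<epsilon> / (N powr s + 1))"
        using e by (intro mult_mono) (auto simp: e_def)
      also have "\<dots> = \<epsilon>" using powr_ge_zero[of N s] by (smt (verit) nonzero_mult_div_cancel_left times_divide_eq_right)
      finally show ?thesis using e by (simp add: ennreal_leI flip: ennreal_mult)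
    qed
    finally show ?thesis by simp
  qed
  have "hausdorff_premeasure s \<delta> (g ` A) \<le> 0" if "0 < \<delta>" for \<delta>
    by (rule ennreal_le_epsilon) (use * that in blast)
  then have "hausdorff_measure s (g ` A) \<le> 0"
    unfolding hausdorff_measure_def by (intro SUP_least) simp
  then show ?thesis by simp
qed

section \<open>Small projections under the invariant measure\<close>

lemma orth_proj_orthogonal_image:
  assumes g: "orthogonal_transformation g" and V: "subspace V"
  shows "orth_proj (g ` V) (g x) = g (orth_proj V x)"
proof (rule orth_proj_unique)
  have lin: "linear g" using g by (simp add: orthogonal_transformation_linear)
  then show "subspace (g ` V)" using V by (rule linear_subspace_image)
  show "g (orth_proj V x) \<in> g ` V" using V by (simp add: orth_proj_mem)
  fix v assume "v \<in> g ` V"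
  then obtain v' where "v' \<in> V" "v = g v'" by auto
  then show "orthogonal (g x - g (orth_proj V x)) v"
    using orth_proj_orthogonal[OF V] g
    by (simp add: orthogonal_orthogonal_transformation flip: linear_diff[OF lin])
qed

section \<open>Measurability in the subspace and orthogonal invariance\<close>

context
  fixes k :: nat and \<gamma> :: "'a::euclidean_space set measure"
  assumes \<gamma>: "is_grassmann_measure k \<gamma>"
begin

interpretation prob_space \<gamma> using \<gamma> by (simp add: is_grassmann_measure_def)

lemma space_grassmann: "V \<in> space \<gamma> \<longleftrightarrow> subspace V \<and> dim V = k"
  using \<gamma> by (auto simp: is_grassmann_measure_def grassmannian_def)

text \<open>The function is Lipschitz for \<open>grassmann_dist\<close> with constant
  \<open>norm x * norm y\<close>, so preimages of open sets are open.\<close>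

lemma measurable_orth_proj_inner: "(\<lambda>V. orth_proj V x \<bullet> y) \<in> borel_measurable \<gamma>"
proof (rule borel_measurableI)
  fix S :: "real set" assume S: "open S"
  interpret Metric_space "grassmannian k :: 'a set set" grassmann_dist
    by (rule Metric_space_grassmannian)
  let ?U = "(\<lambda>V. orth_proj V x \<bullet> y) -` S \<inter> space \<gamma>"
  have "openin (grassmann_topology k) ?U"
    unfolding grassmann_topology_def openin_mtopology
  proof (intro conjI allI impI)
    show "?U \<subseteq> grassmannian k" using \<gamma> by (auto simp: is_grassmann_measure_def)
    fix V assume V: "V \<in> ?U"
    then obtain e where e: "0 < e" "\<And>t. dist t (orth_proj V x \<bullet> y) < e \<Longrightarrow> t \<in> S"
      using S unfolding open_dist by (auto simp: dist_commute)
    \<comment> \<open>The added 1 allows \<open>x\<close> or \<open>y\<close> to vanish and makes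
      the final estimate strict.\<close>
    define r where "r = e / (norm x * norm y + 1)"
    have r: "0 < r" using e by (auto simp: r_def add_nonneg_pos)
    have "W \<in> ?U" if W: "W \<in> mball V r" for W
    proof -
      have WG: "W \<in> grassmannian k" using W by simp
      have sub: "subspace V" "subspace W" and Wk: "W \<in> space \<gamma>"
        using V WG by (auto simp: space_grassmann grassmannian_def)
      have d: "grassmann_dist V W < r" using W by simp
      have "\<bar>(orth_proj V x - orth_proj W x) \<bullet> y\<bar> \<le> norm (orth_proj V x - orth_proj W x) * norm y"
        by (rule Cauchy_Schwarz_ineq2)
      also have "\<dots> \<le> (grassmann_dist V W * norm x) * norm y"
        using onorm[OF bounded_linear_orth_proj_diff[OF sub], of x] sub
        by (intro mult_right_mono) (auto simp: grassmann_dist_def)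
      also have "\<dots> \<le> r * (norm x * norm y)"
        using d by (simp add: mult.assoc mult_right_mono)
      also have "\<dots> < r * (norm x * norm y + 1)" using r by simp
      also have "\<dots> = e" unfolding r_def by (smt (verit) mult_nonneg_nonneg nonzero_eq_divide_eq norm_ge_zero)
      finally have "orth_proj W x \<bullet> y \<in> S"
        by (intro e) (simp add: dist_real_def inner_diff_left abs_minus_commute)
      then show ?thesis using Wk by simp
    qed
    then show "\<exists>r>0. mball V r \<subseteq> ?U" using r by blast
  qed
  then show "?U \<in> sets \<gamma>" using \<gamma> by (auto simp: is_grassmann_measure_def)
qed

text \<open>Reduces measurability, also jointly in the subspace and the vector, to finitely many
  matrix entries of the projection.\<close>

lemma norm_orth_proj_expand:
  assumes "subspace V"
  shows "norm (orth_proj V x) =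
    sqrt (\<Sum>b\<in>Basis. \<Sum>b'\<in>Basis. (x \<bullet> b) * (x \<bullet> b') * (orth_proj V b \<bullet> b'))"
proof -
  have "(norm (orth_proj V x))\<^sup>2 = orth_proj V x \<bullet> x"
    using orth_proj_inner[OF assms orth_proj_mem[OF assms], of x x]
    by (simp add: power2_norm_eq_inner inner_commute)
  also have "\<dots> = orth_proj V (\<Sum>b\<in>Basis. (x \<bullet> b) *\<^sub>R b) \<bullet> (\<Sum>b\<in>Basis. (x \<bullet> b) *\<^sub>R b)"
    by (simp add: euclidean_representation)
  also have "\<dots> = (\<Sum>b\<in>Basis. \<Sum>b'\<in>Basis. (x \<bullet> b) * (x \<bullet> b') * (orth_proj V b \<bullet> b'))"
    using linear_orth_proj[OF assms]
    by (simp add: linear_sum linear_cmul inner_sum_left inner_sum_right sum_distrib_left mult.assoc)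
      (subst sum.swap, simp add: mult.left_commute)
  finally show ?thesis by (metis norm_ge_zero real_sqrt_unique)
qed

lemma measurable_norm_orth_proj_pair:
  "(\<lambda>q. norm (orth_proj (fst q) (snd q))) \<in> borel_measurable (\<gamma> \<Otimes>\<^sub>M (borel :: 'a measure))"
proof -
  note measurable_orth_proj_inner[measurable]
  have "(\<lambda>q. sqrt (\<Sum>b\<in>Basis. \<Sum>b'\<in>Basis.
        (snd q \<bullet> b) * (snd q \<bullet> b') * (orth_proj (fst q) b \<bullet> b')))
      \<in> borel_measurable (\<gamma> \<Otimes>\<^sub>M (borel :: 'a measure))"
    by measurable
  then show ?thesis
    by (rule measurable_cong[THEN iffD1, rotated])
      (auto simp: space_pair_measure space_grassmann norm_orth_proj_expand)
qed

lemma measurable_norm_orth_proj [measurable]: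
  "(\<lambda>V. norm (orth_proj V x)) \<in> borel_measurable \<gamma>"
proof -
  note measurable_orth_proj_inner[measurable]
  have "(\<lambda>V. sqrt (\<Sum>b\<in>Basis. \<Sum>b'\<in>Basis. (x \<bullet> b) * (x \<bullet> b') * (orth_proj V b \<bullet> b')))
      \<in> borel_measurable \<gamma>"
    by measurable
  then show ?thesis
    by (rule measurable_cong[THEN iffD1, rotated]) (auto simp: space_grassmann norm_orth_proj_expand)
qed

text \<open>Since invariance is formulated with images, the point is that \<open>g\<close> maps one
  event exactly onto the other.\<close>

lemma emeasure_orth_proj_small_invariant:
  assumes g: "orthogonal_transformation g"
  shows "emeasure \<gamma> {V\<in>space \<gamma>. norm (orth_proj V (g x)) \<le> r}
    = emeasure \<gamma> {V\<in>space \<gamma>. norm (orth_proj V x) \<le> r}"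
proof -
  have lin: "linear g" and inj: "inj g" and surj: "surj g"
    using g by (auto simp: orthogonal_transformation_linear orthogonal_transformation_inj
        orthogonal_transformation_surj)
  have D: "dim (h ` V) = dim V" if "orthogonal_transformation h" for h :: "'a \<Rightarrow> 'a" and V
    using that by (intro dim_image_eq)
      (auto simp: orthogonal_transformation_linear intro: inj_on_subset[OF orthogonal_transformation_inj])
  have N: "norm (orth_proj (g ` V) (g x)) = norm (orth_proj V x)" if "subspace V" for V
    using g that by (simp add: orth_proj_orthogonal_image orthogonal_transformation_norm)
  have image: "(\<lambda>V. g ` V) ` {V\<in>space \<gamma>. norm (orth_proj V x) \<le> r}
      = {V\<in>space \<gamma>. norm (orth_proj V (g x)) \<le> r}"
  proof (intro equalityI subsetI)
    fix W assume "W \<in> (\<lambda>V. g ` V) ` {V\<in>space \<gamma>. norm (orth_proj V x) \<le> r}"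
    then show "W \<in> {V\<in>space \<gamma>. norm (orth_proj V (g x)) \<le> r}"
      using N lin D[OF g] by (auto simp: space_grassmann linear_subspace_image)
  next
    fix W assume W: "W \<in> {V\<in>space \<gamma>. norm (orth_proj V (g x)) \<le> r}"
    define V where "V = inv g ` W"
    have inv: "orthogonal_transformation (inv g)" using g by (rule orthogonal_transformation_inv)
    then have V: "subspace V" "dim V = k"
      using W D[OF inv] by (auto simp: V_def space_grassmann linear_subspace_image
          orthogonal_transformation_linear)
    have "W = g ` V" using surj by (simp add: V_def image_image surj_f_inv_f)
    with V W N[OF V(1)] show "W \<in> (\<lambda>V. g ` V) ` {V\<in>space \<gamma>. norm (orth_proj V x) \<le> r}"
      by (auto simp: space_grassmann)
  qed
  have "{V\<in>space \<gamma>. norm (orth_proj V x) \<le> r} \<in> sets \<gamma>" by measurable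
  then have "emeasure \<gamma> ((\<lambda>V. g ` V) ` {V\<in>space \<gamma>. norm (orth_proj V x) \<le> r})
      = emeasure \<gamma> {V\<in>space \<gamma>. norm (orth_proj V x) \<le> r}"
    using \<gamma> g unfolding is_grassmann_measure_def by blast
  then show ?thesis unfolding image .
qed

end

text \<open>In an orthonormal basis adapted to \<open>V\<close> and its complement, the set lies in
  a box with k sides of order 2^-j and the other sides of order 1. It meets at most 3^N 2^(j(N-k))
  grid cells, N being the dimension of the space, and each of them fits into a ball of radius N
  2^-j.\<close>

lemma emeasure_small_projection:
  fixes V :: "'a::euclidean_space set"
  assumes V: "subspace V" "dim V = k"
  shows "emeasure lborel {x. norm x \<le> 1 \<and> norm (orth_proj V x) \<le> (1/2) ^ j}
    \<le> ennreal (3 ^ DIM('a) * unit_ball_vol DIM('a) * real DIM('a) ^ DIM('a) * (1/2) ^ (j * k))"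
proof -
  define N where "N = DIM('a)"
  define V' where "V' = {y. \<forall>x\<in>V. orthogonal x y}"
  define S where "S = {x. norm x \<le> 1 \<and> norm (orth_proj V x) \<le> (1/2) ^ j}"
  have V': "subspace V'" unfolding V'_def by (rule subspace_orthogonal_to_vectors)
  have "dim V' + k = N"
    using dim_subspace_orthogonal_to_vectors[OF V(1) subspace_UNIV] V(2) by (simp add: V'_def N_def)
  obtain B where B: "orthonormal_basis B V" "card B = k"
    using exists_orthonormal_basis[OF V(1)] V(2) by metis
  obtain B' where B': "orthonormal_basis B' V'" "card B' = dim V'"
    using exists_orthonormal_basis[OF V'] by metis
  have BV: "B \<subseteq> V" "B' \<subseteq> V'" "finite B" "finite B'" "\<And>b. b \<in> B \<union> B' \<Longrightarrow> norm b = 1"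
    using B B' by (auto simp: orthonormal_basis_def span_base)
  have dis: "B \<inter> B' = {}"
  proof (rule ccontr)
    assume "B \<inter> B' \<noteq> {}"
    then obtain b where b: "b \<in> B" "b \<in> B'" by auto
    then have "orthogonal b b" using BV by (auto simp: V'_def)
    then show False using BV(5)[of b] b by (simp add: orthogonal_def)
  qed
  have k: "card B' = N - k" "k \<le> N" using \<open>dim V' + k = N\<close> B' by auto
  have part: "\<bar>z \<bullet> b\<bar> \<le> (if b \<in> B then (1/2) ^ j else 1)" if "z \<in> S" "b \<in> B \<union> B'" for z b
  proof (cases "b \<in> B")
    case True
    then have "z \<bullet> b = orth_proj V z \<bullet> b" using BV V by (subst orth_proj_inner) auto
    then have "\<bar>z \<bullet> b\<bar> \<le> norm (orth_proj V z) * norm b" by (simp add: Cauchy_Schwarz_ineq2)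
    then show ?thesis using True that BV(5) by (auto simp: S_def)
  next
    case False
    then show ?thesis using that Cauchy_Schwarz_ineq2[of z b] BV(5)[of b] by (auto simp: S_def)
  qed
  let ?M = "\<lambda>b. \<lceil>2 ^ j * (if b \<in> B then (1/2) ^ j else 1 :: real)\<rceil>"
  have near: "\<bar>grid_cell (B \<union> B') j z b - grid_cell (B \<union> B') j 0 b\<bar> \<le> ?M b"
    if "z \<in> S" "b \<in> B \<union> B'" for z b
    using part[OF that] that(2) by (intro grid_cell_close) auto
  have M0: "0 \<le> ?M b" for b
  proof -
    have "0 \<le> 2 ^ j * (if b \<in> B then (1/2) ^ j else 1 :: real)" by simp
    then show ?thesis by linarith
  qed
  define cells where "cells = grid_cell (B \<union> B') j ` S"
  have "finite (B \<union> B')" using BV by simp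
  note cell = grid_cells_near[where M="?M" and S=S and j=j, OF this M0 near, folded cells_def]
  have "real (card cells) \<le> (\<Prod>b\<in>B \<union> B'. 2 * real_of_int (?M b) + 1)"
    by (rule cell(2))
  also have "\<dots> = (\<Prod>b\<in>B. 2 * real_of_int (?M b) + 1) * (\<Prod>b\<in>B'. 2 * real_of_int (?M b) + 1)"
    by (rule prod.union_disjoint[OF BV(3,4) dis])
  also have "(\<Prod>b\<in>B. 2 * real_of_int (?M b) + 1) = (\<Prod>b\<in>B. 3)"
    by (intro prod.cong refl) (simp add: power_one_over)
  also have "(\<Prod>b\<in>B'. 2 * real_of_int (?M b) + 1) = (\<Prod>b\<in>B'. 2 * 2 ^ j + 1)"
  proof (intro prod.cong refl)
    fix b assume "b \<in> B'"
    then have "b \<notin> B" using dis by auto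
    then show "2 * real_of_int (?M b) + 1 = 2 * 2 ^ j + 1" by simp
  qed
  also have "(\<Prod>b\<in>B. 3) * (\<Prod>b\<in>B'. 2 * 2 ^ j + 1) = 3 ^ k * (2 * 2 ^ j + 1 :: real) ^ (N - k)"
    using B k by simp
  also have "\<dots> \<le> 3 ^ k * (3 * 2 ^ j) ^ (N - k)"
    by (intro mult_left_mono power_mono) auto
  also have "\<dots> = 3 ^ N * 2 ^ (j * (N - k))"
    using k(2) power_add[of "3::real" k "N - k"] by (simp add: power_mult_distrib power_mult)
  finally have card: "real (card cells) \<le> 3 ^ N * 2 ^ (j * (N - k))" .
  \<comment> \<open>Two points of a cell differ by at most 2^-j in each of the N coordinates, and
    the norm is at most the sum of the coordinates.\<close>
  define \<rho> :: real where "\<rho> = real N * (1/2) ^ j"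
  have \<rho>: "0 \<le> \<rho>" by (simp add: \<rho>_def)
  have close: "dist x y \<le> \<rho>" if "grid_cell (B \<union> B') j x = grid_cell (B \<union> B') j y" for x y
  proof -
    define z where "z = x - y"
    have zb: "\<bar>z \<bullet> b\<bar> \<le> (1/2) ^ j" if "b \<in> B \<union> B'" for b
      using grid_cell_eq_imp_close[OF \<open>grid_cell (B \<union> B') j x = grid_cell (B \<union> B') j y\<close> that]
      by (simp add: z_def)
    have zV': "z - orth_proj V z \<in> V'"
      using orth_proj_orthogonal[OF V(1)] by (auto simp: V'_def orthogonal_commute)
    have "norm z \<le> norm (orth_proj V z) + norm (z - orth_proj V z)"
      using norm_triangle_ineq[of "orth_proj V z" "z - orth_proj V z"] by simp
    also have "\<dots> \<le> (\<Sum>b\<in>B. \<bar>orth_proj V z \<bullet> b\<bar>) + (\<Sum>b\<in>B'. \<bar>(z - orth_proj V z) \<bullet> b\<bar>)"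
      by (intro add_mono norm_le_sum_orthonormal_basis[OF B(1)]
          norm_le_sum_orthonormal_basis[OF B'(1)] zV' orth_proj_mem V)
    also have "(\<Sum>b\<in>B. \<bar>orth_proj V z \<bullet> b\<bar>) \<le> (\<Sum>b\<in>B. (1/2) ^ j)"
      using BV V zb by (intro sum_mono) (auto simp: orth_proj_inner)
    also have "(\<Sum>b\<in>B'. \<bar>(z - orth_proj V z) \<bullet> b\<bar>) \<le> (\<Sum>b\<in>B'. (1/2) ^ j)"
    proof (rule sum_mono)
      fix b assume b: "b \<in> B'"
      then have "orthogonal (orth_proj V z) b"
        using BV(2) orth_proj_mem[OF V(1)] by (auto simp: V'_def)
      then show "\<bar>(z - orth_proj V z) \<bullet> b\<bar> \<le> (1/2) ^ j"
        using zb[of b] b by (simp add: inner_diff_left orthogonal_def)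
    qed
    also have "(\<Sum>b\<in>B. (1/2) ^ j) + (\<Sum>b\<in>B'. (1/2) ^ j) = \<rho>"
      using B k by (simp add: \<rho>_def of_nat_diff algebra_simps)
    finally show ?thesis by (simp add: z_def dist_norm)
  qed
  \<comment> \<open>One point of \<open>S\<close> in each cell that meets it serves as the centre of
    a ball.\<close>
  define p where "p = inv_into S (grid_cell (B \<union> B') j)"
  have p: "grid_cell (B \<union> B') j (p a) = a" if "a \<in> cells" for a
    using that by (simp add: p_def cells_def f_inv_into_f)
  have "S \<subseteq> (\<Union>a\<in>cells. cball (p a) \<rho>)"
  proof
    fix x assume "x \<in> S"
    then have a: "grid_cell (B \<union> B') j x \<in> cells" by (simp add: cells_def)
    have "dist (p (grid_cell (B \<union> B') j x)) x \<le> \<rho>" using p[OF a] by (rule close)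
    then show "x \<in> (\<Union>a\<in>cells. cball (p a) \<rho>)" using a by auto
  qed
  then have "emeasure lborel S \<le> emeasure lborel (\<Union>a\<in>cells. cball (p a) \<rho>)"
    using cell(1) by (intro emeasure_mono) auto
  also have "\<dots> \<le> (\<Sum>a\<in>cells. emeasure lborel (cball (p a) \<rho>))"
    using cell(1) by (intro emeasure_subadditive_finite) auto
  also have "\<dots> = (\<Sum>a\<in>cells. ennreal (unit_ball_vol N * \<rho> ^ N))"
    using \<rho> by (simp add: emeasure_cball N_def)
  also have "\<dots> = ennreal (real (card cells) * (unit_ball_vol N * \<rho> ^ N))"
    using \<rho> by (simp add: ennreal_mult ennreal_of_nat_eq_real_of_nat)
  also have "\<dots> \<le> ennreal ((3 ^ N * 2 ^ (j * (N - k))) * (unit_ball_vol N * \<rho> ^ N))"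
    using \<rho> card by (intro ennreal_leI mult_right_mono) auto
  also have "(3 ^ N * 2 ^ (j * (N - k))) * (unit_ball_vol N * \<rho> ^ N)
      = 3 ^ N * unit_ball_vol N * real N ^ N * (1/2) ^ (j * k)"
  proof -
    have "(2::real) ^ (j * (N - k)) * ((1/2) ^ j) ^ N = (1/2) ^ (j * k)"
    proof -
      have "((1/2::real) ^ j) ^ N = (1/2) ^ (j * (N - k)) * (1/2) ^ (j * k)"
        using k(2) by (simp add: power_mult[symmetric] power_add[symmetric] distrib_left[symmetric])
      then show ?thesis by (simp add: power_one_over)
    qed
    then show ?thesis by (simp add: \<rho>_def power_mult_distrib mult.commute mult.left_commute)
  qed
  finally show ?thesis by (simp add: S_def N_def)
qed

text \<open>By invariance, the probability depends on the length of \<open>e\<close> only. It is therefore bounded by its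
  Lebesgue average over the unit ball, which Fubini's theorem turns into the volume of a
  neighbourhood of the orthogonal complement of \<open>V\<close>.\<close>

lemma emeasure_orth_proj_small:
  fixes \<gamma> :: "(real ^ 'p) set measure"
  assumes \<gamma>: "is_grassmann_measure k \<gamma>"
  shows "\<exists>C\<ge>0. \<forall>e j. norm e = 1 \<longrightarrow>
    emeasure \<gamma> {V\<in>space \<gamma>. norm (orth_proj V e) \<le> (1/2) ^ j} \<le> ennreal (C * (1/2) ^ (j * k))"
proof -
  interpret prob_space \<gamma> using \<gamma> by (simp add: is_grassmann_measure_def)
  let ?N = "DIM(real ^ 'p)"
  define K where "K = 3 ^ ?N * unit_ball_vol ?N * real ?N ^ ?N"
  have v0: "0 < unit_ball_vol (real ?N)" by simp
  have bound: "emeasure \<gamma> {V\<in>space \<gamma>. norm (orth_proj V e) \<le> (1/2) ^ j}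
      \<le> ennreal (K / unit_ball_vol ?N * (1/2) ^ (j * k))" if e: "norm e = 1" for e :: "real ^ 'p" and j
  proof -
    define r :: real where "r = (1/2) ^ j"
    define \<phi> where "\<phi> x = emeasure \<gamma> {V\<in>space \<gamma>. norm (orth_proj V x) \<le> r}" for x
    interpret pair_sigma_finite \<gamma> "lborel :: (real ^ 'p) measure" ..
    have \<phi>: "\<phi> e \<le> \<phi> x" if x: "x \<in> cball 0 1" for x
    proof -
      obtain g where g: "orthogonal_transformation g" "g (norm x *\<^sub>R e) = x"
        using orthogonal_transformation_exists[of "norm x *\<^sub>R e" x] e by auto
      \<comment> \<open>Shortening \<open>e\<close> only enlarges the event, and the shortened
        vector is rotated to \<open>x\<close> by \<open>g\<close>.\<close>
      have "\<phi> e \<le> \<phi> (norm x *\<^sub>R e)"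
        unfolding \<phi>_def
      proof (rule emeasure_mono)
        show "{V\<in>space \<gamma>. norm (orth_proj V e) \<le> r} \<subseteq> {V\<in>space \<gamma>. norm (orth_proj V (norm x *\<^sub>R e)) \<le> r}"
        proof clarsimp
          fix V assume V: "V \<in> space \<gamma>" "norm (orth_proj V e) \<le> r"
          have "norm (orth_proj V (norm x *\<^sub>R e)) = norm x * norm (orth_proj V e)"
            using V(1) \<gamma> by (simp add: space_grassmann linear_cmul[OF linear_orth_proj])
          also have "\<dots> \<le> 1 * norm (orth_proj V e)" using x by (intro mult_right_mono) auto
          finally show "norm (orth_proj V (norm x *\<^sub>R e)) \<le> r" using V(2) by simp
        qed
        show "{V\<in>space \<gamma>. norm (orth_proj V (norm x *\<^sub>R e)) \<le> r} \<in> sets \<gamma>"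
          using measurable_norm_orth_proj[OF \<gamma>, measurable] by measurable
      qed
      also have "\<dots> = \<phi> x"
        using emeasure_orth_proj_small_invariant[OF \<gamma> g(1), of "norm x *\<^sub>R e" r] g(2)
        by (simp add: \<phi>_def)
      finally show ?thesis .
    qed
    define F :: "(real ^ 'p) set \<Rightarrow> real ^ 'p \<Rightarrow> ennreal"
      where "F V x = indicator {(V, x). x \<in> cball 0 1 \<and> norm (orth_proj V x) \<le> r} (V, x)" for V x
    have F: "case_prod F \<in> borel_measurable (\<gamma> \<Otimes>\<^sub>M lborel)"
    proof -
      note measurable_norm_orth_proj_pair[OF \<gamma>, measurable]
      have "(\<lambda>q. if norm (snd q) \<le> 1 \<and> norm (orth_proj (fst q) (snd q)) \<le> r then 1 else 0 :: ennreal)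
          \<in> borel_measurable (\<gamma> \<Otimes>\<^sub>M borel)"
        by measurable
      moreover have "case_prod F = (\<lambda>q. if norm (snd q) \<le> 1 \<and> norm (orth_proj (fst q) (snd q)) \<le> r
          then 1 else 0)"
        by (auto simp: F_def fun_eq_iff)
      ultimately show ?thesis
        by (simp cong: measurable_cong_sets sets_pair_measure_cong)
    qed
    have "\<phi> e * ennreal (unit_ball_vol ?N) = (\<integral>\<^sup>+x. \<phi> e * indicator (cball 0 1) (x :: real ^ 'p) \<partial>lborel)"
      by (subst nn_integral_cmult_indicator) (simp_all add: emeasure_cball)
    also have "\<dots> \<le> (\<integral>\<^sup>+x. (\<integral>\<^sup>+V. F V x \<partial>\<gamma>) \<partial>lborel)"
    proof (rule nn_integral_mono)
      fix x :: "real ^ 'p"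
      show "\<phi> e * indicator (cball 0 1) x \<le> (\<integral>\<^sup>+V. F V x \<partial>\<gamma>)"
      proof (cases "x \<in> cball 0 1")
        case True
        have "\<phi> x = (\<integral>\<^sup>+V. indicator {V\<in>space \<gamma>. norm (orth_proj V x) \<le> r} V \<partial>\<gamma>)"
          unfolding \<phi>_def using measurable_norm_orth_proj[OF \<gamma>, measurable]
          by (intro nn_integral_indicator[symmetric]) measurable
        also have "\<dots> = (\<integral>\<^sup>+V. F V x \<partial>\<gamma>)"
          using True by (intro nn_integral_cong) (auto simp: F_def indicator_def)
        finally show ?thesis using \<phi>[OF True] True by simp
      qed simp
    qed
    also have "\<dots> = (\<integral>\<^sup>+V. (\<integral>\<^sup>+x. F V x \<partial>lborel) \<partial>\<gamma>)"
      by (rule Fubini'[OF F])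
    also have "\<dots> \<le> (\<integral>\<^sup>+V. ennreal (K * (1/2) ^ (j * k)) \<partial>\<gamma>)"
    proof (rule nn_integral_mono)
      fix V assume "V \<in> space \<gamma>"
      then have V: "subspace V" "dim V = k" using \<gamma> by (auto simp: space_grassmann)
      have "continuous_on UNIV (orth_proj V)"
        using linear_orth_proj[OF V(1)] by (rule linear_continuous_on[OF linear_linear[THEN iffD2]])
      then have meas: "orth_proj V \<in> borel_measurable borel" by (rule borel_measurable_continuous_onI)
      have "(\<integral>\<^sup>+x. F V x \<partial>lborel)
          = (\<integral>\<^sup>+x. indicator {x. norm x \<le> 1 \<and> norm (orth_proj V x) \<le> (1/2) ^ j} x \<partial>lborel)"
        by (intro nn_integral_cong) (auto simp: F_def indicator_def r_def)
      also have "\<dots> = emeasure lborel {x. norm x \<le> 1 \<and> norm (orth_proj V x) \<le> (1/2) ^ j}"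
        using meas[measurable] by (intro nn_integral_indicator) simp
      also have "\<dots> \<le> ennreal (K * (1/2) ^ (j * k))"
        unfolding K_def by (rule emeasure_small_projection[OF V])
      finally show "(\<integral>\<^sup>+x. F V x \<partial>lborel) \<le> ennreal (K * (1/2) ^ (j * k))" .
    qed
    also have "\<dots> = ennreal (K * (1/2) ^ (j * k))" by (simp add: emeasure_space_1)
    finally have "\<phi> e * ennreal (unit_ball_vol ?N) \<le> ennreal (K * (1/2) ^ (j * k))" .
    then have "prob {V\<in>space \<gamma>. norm (orth_proj V e) \<le> r} * unit_ball_vol ?N \<le> K * (1/2) ^ (j * k)"
      by (simp add: \<phi>_def emeasure_eq_measure K_def flip: ennreal_mult)
    then have "prob {V\<in>space \<gamma>. norm (orth_proj V e) \<le> r} \<le> K / unit_ball_vol ?N * (1/2) ^ (j * k)"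
      using v0 by (simp add: field_simps)
    then show ?thesis by (simp add: emeasure_eq_measure r_def ennreal_leI)
  qed
  have "0 \<le> K / unit_ball_vol ?N" by (simp add: K_def)
  with bound show ?thesis by blast
qed

section \<open>Energy of projections in terms of grid cells\<close>

lemma orth_proj_Times_UNIV:
  assumes "subspace V"
  shows "orth_proj (V \<times> UNIV) (u, v) = (orth_proj V u, v)"
proof (rule orth_proj_unique)
  show "subspace (V \<times> (UNIV :: 'b set))" using assms by (simp add: subspace_Times)
  show "(orth_proj V u, v) \<in> V \<times> UNIV" using assms by (simp add: orth_proj_mem)
  fix x :: "'a \<times> 'b" assume "x \<in> V \<times> UNIV"
  then show "orthogonal ((u, v) - (orth_proj V u, v)) x"
    using orth_proj_orthogonal[OF assms, of "fst x" u]
    by (auto simp: orthogonal_def inner_prod_def)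
qed

abbreviation product_basis :: "'a::euclidean_space set \<Rightarrow> ('a \<times> 'b::euclidean_space) set"
  where "product_basis B \<equiv> (\<lambda>b. (b, 0)) ` B \<union> (\<lambda>b. (0, b)) ` Basis"

lemma orthonormal_basis_product:
  assumes "orthonormal_basis B W"
  shows "orthonormal_basis (product_basis B) (W \<times> (UNIV :: 'b::euclidean_space set))"
    (is "orthonormal_basis ?D _")
  unfolding orthonormal_basis_def
proof (intro conjI)
  have B: "finite B" "pairwise orthogonal B" "\<And>b. b \<in> B \<Longrightarrow> norm b = 1" "span B = W"
    using assms by (auto simp: orthonormal_basis_def)
  show "finite ?D" using B by simp
  show "pairwise orthogonal ?D"
    using B(2) inner_not_same_Basis unfolding pairwise_def orthogonal_def by (fastforce simp: inner_Pair)
  show "\<forall>b\<in>?D. norm b = 1" using B(3) by (auto simp: norm_Pair)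
  show "span ?D = W \<times> UNIV"
  proof (rule antisym)
    have "?D \<subseteq> W \<times> UNIV" using B(4) by (auto simp: span_base span_0)
    then show "span ?D \<subseteq> W \<times> UNIV"
      using B(4) by (intro span_minimal) (auto simp: subspace_Times)
    show "W \<times> UNIV \<subseteq> span ?D"
    proof clarify
      fix u :: 'a and v :: 'b assume u: "u \<in> W"
      have "linear (\<lambda>b::'a. (b, 0::'b))" "linear (\<lambda>b::'b. (0::'a, b))"
        by (auto intro!: linearI)
      then have "span ((\<lambda>b. (b, 0::'b)) ` B) = (\<lambda>b. (b, 0)) ` W"
          "span ((\<lambda>b. (0::'a, b)) ` (Basis :: 'b set)) = (\<lambda>b. (0, b)) ` UNIV"
        using B(4) by (auto simp: linear_span_image)
      then have "(u, 0) \<in> span ?D" "(0, v) \<in> span ?D"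
        using u span_mono[of "(\<lambda>b. (b, 0)) ` B" ?D] span_mono[of "(\<lambda>b. (0, b)) ` Basis" ?D] by blast+
      from span_add[OF this] show "(u, v) \<in> span ?D" by simp
    qed
  qed
qed

text \<open>The slab spans at most 2 * 2^i + 1 cells in each of the k directions of \<open>W\<close>
  and three in each direction of the second factor; every cell carries at most
  \<open>M\<close>.\<close>

lemma weight_of_slab:
  fixes z\<^sub>0 :: "'a::euclidean_space \<times> 'b::euclidean_space" and p :: "'a \<times> 'b \<Rightarrow> real"
  assumes B: "orthonormal_basis B W" "card B = k"
    and S: "finite S" "\<And>z. z \<in> S \<Longrightarrow> 0 \<le> p z"
    and cells: "\<And>a. (\<Sum>z\<in>{z\<in>S. grid_cell (product_basis B) j z = a}. p z) \<le> M"
  shows "(\<Sum>z\<in>{z\<in>S. norm (fst z - fst z\<^sub>0) \<le> 2 ^ i * (1/2) ^ j \<and> norm (snd z - snd z\<^sub>0) \<le> (1/2) ^ j}. p z)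
    \<le> 3 ^ (k + DIM('b)) * 2 ^ (i * k) * M"
proof -
  define D :: "('a \<times> 'b) set" where "D = product_basis B"
  define D1 :: "('a \<times> 'b) set" where "D1 = (\<lambda>b. (b, 0)) ` B"
  define D2 :: "('a \<times> 'b) set" where "D2 = (\<lambda>b. (0, b)) ` Basis"
  define T where "T = {z\<in>S. norm (fst z - fst z\<^sub>0) \<le> 2 ^ i * (1/2) ^ j \<and> norm (snd z - snd z\<^sub>0) \<le> (1/2) ^ j}"
  have fB: "finite B" and nB: "\<And>b. b \<in> B \<Longrightarrow> norm b = 1"
    using B by (auto simp: orthonormal_basis_def)
  have D: "D = D1 \<union> D2" "finite D1" "finite D2" "D1 \<inter> D2 = {}"
    using nB fB by (auto simp: D_def D1_def D2_def)
  have card: "card D1 = k" "card D2 = DIM('b)"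
    using B by (auto simp: D1_def D2_def card_image inj_on_def)
  define m :: "'a \<times> 'b \<Rightarrow> int" where "m b = (if b \<in> D1 then 2 ^ i else 1)" for b
  have near: "\<bar>grid_cell D j z b - grid_cell D j z\<^sub>0 b\<bar> \<le> m b" if z: "z \<in> T" and b: "b \<in> D" for z b
  proof -
    define r :: real where "r = (if b \<in> D1 then 2 ^ i * (1/2) ^ j else (1/2) ^ j)"
    have "\<bar>(z - z\<^sub>0) \<bullet> b\<bar> \<le> r"
    proof (cases "b \<in> D1")
      case True
      then obtain b' where b': "b = (b', 0)" "norm b' = 1" using nB by (auto simp: D1_def)
      show ?thesis using Cauchy_Schwarz_ineq2[of "fst z - fst z\<^sub>0" b'] z True b'
        by (auto simp: inner_prod_def T_def r_def)
    next
      case False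
      then obtain b' where b': "b = (0, b')" "norm b' = 1" using b D by (auto simp: D2_def)
      show ?thesis using Cauchy_Schwarz_ineq2[of "snd z - snd z\<^sub>0" b'] z False b'
        by (auto simp: inner_prod_def T_def r_def)
    qed
    from grid_cell_close[OF this b, of j]
    have "\<bar>grid_cell D j z b - grid_cell D j z\<^sub>0 b\<bar> \<le> \<lceil>2 ^ j * r\<rceil>" .
    moreover have "2 ^ j * r = of_int (m b)" by (simp add: r_def m_def power_one_over)
    ultimately show ?thesis by simp
  qed
  have "finite D" using D by simp
  note cell = grid_cells_near[where M=m and S=T and j=j, OF this _ near]
  have m0: "0 \<le> m b" for b by (simp add: m_def)
  have "real (card (grid_cell D j ` T)) \<le> (\<Prod>b\<in>D. 2 * real_of_int (m b) + 1)"
    by (rule cell(2)[OF m0])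
  also have "\<dots> = (\<Prod>b\<in>D1. 2 * real_of_int (m b) + 1) * (\<Prod>b\<in>D2. 2 * real_of_int (m b) + 1)"
    unfolding D(1) by (rule prod.union_disjoint[OF D(2-4)])
  also have "(\<Prod>b\<in>D1. 2 * real_of_int (m b) + 1) = (\<Prod>b\<in>D1. 2 * 2 ^ i + 1)"
    by (intro prod.cong refl) (simp add: m_def)
  also have "(\<Prod>b\<in>D2. 2 * real_of_int (m b) + 1) = (\<Prod>b\<in>D2. 3)"
  proof (intro prod.cong refl)
    fix b assume "b \<in> D2"
    then have "b \<notin> D1" using D(4) by auto
    then show "2 * real_of_int (m b) + 1 = 3" by (simp add: m_def)
  qed
  also have "(\<Prod>b\<in>D1. 2 * 2 ^ i + 1) * (\<Prod>b\<in>D2. 3) = (2 * 2 ^ i + 1 :: real) ^ k * 3 ^ DIM('b)"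
    using card by simp
  also have "\<dots> \<le> (3 * 2 ^ i) ^ k * 3 ^ DIM('b)"
    by (intro mult_right_mono power_mono) auto
  also have "\<dots> = 3 ^ (k + DIM('b)) * 2 ^ (i * k)"
    by (simp add: power_mult_distrib power_mult power_add)
  finally have count: "real (card (grid_cell D j ` T)) \<le> 3 ^ (k + DIM('b)) * 2 ^ (i * k)" .
  have fT: "finite T" using S by (simp add: T_def)
  \<comment> \<open>\<open>undefined\<close> stands for an arbitrary label; the bound there already
    forces \<open>M\<close> to be nonnegative.\<close>
  have "0 \<le> (\<Sum>z\<in>{z\<in>S. grid_cell (product_basis B) j z = undefined}. p z)"
    using S(2) by (intro sum_nonneg) auto
  then have M0: "0 \<le> M" using cells[of undefined] by linarith
  have "(\<Sum>z\<in>T. p z) = (\<Sum>a\<in>grid_cell D j ` T. \<Sum>z\<in>{z\<in>T. grid_cell D j z = a}. p z)"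
    by (rule sum.image_gen[OF fT])
  also have "\<dots> \<le> (\<Sum>a\<in>grid_cell D j ` T. M)"
  proof (rule sum_mono)
    fix a
    have "(\<Sum>z\<in>{z\<in>T. grid_cell D j z = a}. p z) \<le> (\<Sum>z\<in>{z\<in>S. grid_cell D j z = a}. p z)"
      using S by (intro sum_mono2) (auto simp: T_def)
    also have "\<dots> \<le> M" unfolding D_def by (rule cells)
    finally show "(\<Sum>z\<in>{z\<in>T. grid_cell D j z = a}. p z) \<le> M" .
  qed
  also have "\<dots> = real (card (grid_cell D j ` T)) * M" by simp
  also have "\<dots> \<le> 3 ^ (k + DIM('b)) * 2 ^ (i * k) * M"
    using count M0 by (rule mult_right_mono)
  finally show ?thesis by (simp add: T_def)
qed

text \<open>Dyadic decomposition in the size of \<open>u\<close>, so that the factor \<open>(1/2) ^ (i * k)\<close> compensates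
  the number of grid cells met by a slab of size \<open>2 ^ i\<close>.\<close>

lemma prob_orth_proj_small_dyadic:
  fixes \<gamma> :: "(real ^ 'p) set measure"
  assumes \<gamma>: "is_grassmann_measure k \<gamma>"
  shows "\<exists>C\<ge>0. \<forall>u j I. norm u \<le> 2 ^ I * (1/2) ^ j \<longrightarrow>
    measure \<gamma> {V\<in>space \<gamma>. norm (orth_proj V u) \<le> (1/2) ^ j}
      \<le> (\<Sum>i\<le>I. C * (1/2) ^ (i * k) * of_bool (norm u \<le> 2 ^ i * (1/2) ^ j))"
proof -
  interpret prob_space \<gamma> using \<gamma> by (simp add: is_grassmann_measure_def)
  obtain C where C: "0 \<le> C" "\<And>e j. norm e = 1 \<Longrightarrow>
      emeasure \<gamma> {V\<in>space \<gamma>. norm (orth_proj V e) \<le> (1/2) ^ j} \<le> ennreal (C * (1/2) ^ (j * k))"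
    using emeasure_orth_proj_small[OF \<gamma>] by blast
  \<comment> \<open>The 1 covers the smallest size, where the probability is only bounded by 1. The
    factor 2^k pays for replacing i - 1 by i.\<close>
  define C' where "C' = max 1 (C * 2 ^ k)"
  have C': "1 \<le> C'" "C * 2 ^ k \<le> C'" by (auto simp: C'_def)
  have "prob {V\<in>space \<gamma>. norm (orth_proj V u) \<le> (1/2) ^ j}
      \<le> (\<Sum>i\<le>I. C' * (1/2) ^ (i * k) * of_bool (norm u \<le> 2 ^ i * (1/2) ^ j))"
    if I: "norm u \<le> 2 ^ I * (1/2) ^ j" for u :: "real ^ 'p" and j I :: nat
  proof -
    \<comment> \<open>For i > 0, minimality gives norm u > 2^(i-1) 2^-j, so normalising
      \<open>u\<close> turns the threshold 2^-j into at most 2^-(i-1).\<close>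
    define i where "i = (LEAST i. norm u \<le> 2 ^ i * (1/2) ^ j)"
    have i: "norm u \<le> 2 ^ i * (1/2) ^ j" "i \<le> I"
      unfolding i_def using I LeastI[of "\<lambda>i. norm u \<le> 2 ^ i * (1/2) ^ j" I]
      by (auto intro: Least_le)
    have "prob {V\<in>space \<gamma>. norm (orth_proj V u) \<le> (1/2) ^ j} \<le> C' * (1/2) ^ (i * k)"
    proof (cases i)
      case 0
      then show ?thesis using C'(1) prob_le_1 by (auto intro: order_trans)
    next
      case (Suc i')
      then have "i' < i" by simp
      then have u: "2 ^ i' * (1/2) ^ j < norm u"
        using not_less_Least[of i' "\<lambda>i. norm u \<le> 2 ^ i * (1/2) ^ j"] by (simp add: i_def)
      then have u0: "0 < norm u" by (smt (verit) zero_le_mult_iff zero_le_power zero_le_divide_1_iff)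
      define e where "e = u /\<^sub>R norm u"
      have e: "norm e = 1" using u0 by (simp add: e_def)
      have "prob {V\<in>space \<gamma>. norm (orth_proj V u) \<le> (1/2) ^ j}
          \<le> prob {V\<in>space \<gamma>. norm (orth_proj V e) \<le> (1/2) ^ i'}"
      proof (rule finite_measure_mono)
        show "{V\<in>space \<gamma>. norm (orth_proj V e) \<le> (1/2) ^ i'} \<in> events"
          using measurable_norm_orth_proj[OF \<gamma>, measurable] by measurable
        show "{V\<in>space \<gamma>. norm (orth_proj V u) \<le> (1/2) ^ j}
            \<subseteq> {V\<in>space \<gamma>. norm (orth_proj V e) \<le> (1/2) ^ i'}"
        proof clarsimp
          fix V assume V: "V \<in> space \<gamma>" "norm (orth_proj V u) \<le> (1/2) ^ j"
          have "norm (orth_proj V e) = norm (orth_proj V u) / norm u"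
            using V(1) \<gamma> by (simp add: e_def space_grassmann linear_cmul[OF linear_orth_proj] divide_inverse_commute)
          also have "\<dots> \<le> (1/2) ^ j / norm u" using V(2) u0 by (simp add: divide_right_mono)
          also have "\<dots> \<le> (1/2) ^ i'" using u u0 by (simp add: field_simps)
          finally show "norm (orth_proj V e) \<le> (1/2) ^ i'" .
        qed
      qed
      also have "\<dots> \<le> C * (1/2) ^ (i' * k)"
        using C(2)[OF e, of i'] C(1) by (simp add: emeasure_eq_measure)
      also have "\<dots> = C * 2 ^ k * (1/2) ^ (i * k)" by (simp add: Suc power_add power_one_over)
      also have "\<dots> \<le> C' * (1/2) ^ (i * k)" using C'(2) by (intro mult_right_mono) auto
      finally show ?thesis .
    qed
    also have "\<dots> = C' * (1/2) ^ (i * k) * of_bool (norm u \<le> 2 ^ i * (1/2) ^ j)"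
      using i by simp
    \<comment> \<open>One term bounds the probability for this \<open>u\<close>. The full sum has a
      range independent of \<open>u\<close>, so it can be exchanged with a sum over points.\<close>
    also have "\<dots> \<le> (\<Sum>i\<le>I. C' * (1/2) ^ (i * k) * of_bool (norm u \<le> 2 ^ i * (1/2) ^ j))"
      using i(2) C'(1) by (intro member_le_sum) auto
    finally show ?thesis .
  qed
  then show ?thesis using C'(1) by (intro exI[of _ C']) auto
qed

text \<open>\<open>C\<close> is chosen before the weights, the scale and the centre, because the
  weights will change with the truncation level. The factor \<open>real I + 1\<close> counts the
  dyadic sizes of the first component, which all contribute the same bound.\<close>

lemma expected_weight_near:
  fixes \<gamma> :: "(real ^ 'p) set measure"
  assumes \<gamma>: "is_grassmann_measure k \<gamma>"
  shows "\<exists>C\<ge>0. \<forall>B W (S :: ((real ^ 'p) \<times> 'b::euclidean_space) set) p j M I z\<^sub>0.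
    orthonormal_basis B W \<longrightarrow> card B = k \<longrightarrow> finite S \<longrightarrow> (\<forall>z\<in>S. 0 \<le> p z) \<longrightarrow>
    (\<forall>a. (\<Sum>z\<in>{z\<in>S. grid_cell (product_basis B) j z = a}. p z) \<le> M) \<longrightarrow>
    (\<forall>z\<in>S. norm (z - z\<^sub>0) \<le> 2 ^ I * (1/2) ^ j) \<longrightarrow>
    (\<Sum>z\<in>S. p z * measure \<gamma> {V\<in>space \<gamma>. norm (orth_proj (V \<times> UNIV) (z - z\<^sub>0)) \<le> (1/2) ^ j})
      \<le> C * (real I + 1) * M"
proof -
  interpret prob_space \<gamma> using \<gamma> by (simp add: is_grassmann_measure_def)
  obtain C where C: "0 \<le> C" "\<And>u j I. norm u \<le> 2 ^ I * (1/2) ^ j \<Longrightarrow>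
    prob {V\<in>space \<gamma>. norm (orth_proj V u) \<le> (1/2) ^ j}
      \<le> (\<Sum>i\<le>I. C * (1/2) ^ (i * k) * of_bool (norm u \<le> 2 ^ i * (1/2) ^ j))"
    using prob_orth_proj_small_dyadic[OF \<gamma>] by blast
  define K where "K = (3::real) ^ (k + DIM('b))"
  have "(\<Sum>z\<in>S. p z * prob {V\<in>space \<gamma>. norm (orth_proj (V \<times> UNIV) (z - z\<^sub>0)) \<le> (1/2) ^ j})
      \<le> C * K * (real I + 1) * M"
    if B: "orthonormal_basis B W" "card B = k" and S: "finite S" "\<forall>z\<in>S. 0 \<le> p z"
      and cells: "\<forall>a. (\<Sum>z\<in>{z\<in>S. grid_cell (product_basis B) j z = a}. p z) \<le> M"
      and I: "\<forall>z\<in>S. norm (z - z\<^sub>0) \<le> 2 ^ I * (1/2) ^ j"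
    for B W and S :: "((real ^ 'p) \<times> 'b) set" and p j M I z\<^sub>0
  proof -
    define N where "N i z \<longleftrightarrow> norm (fst z - fst z\<^sub>0) \<le> 2 ^ i * (1/2) ^ j
      \<and> norm (snd z - snd z\<^sub>0) \<le> (1/2) ^ j" for i and z :: "(real ^ 'p) \<times> 'b"
    have pr: "prob {V\<in>space \<gamma>. norm (orth_proj (V \<times> UNIV) (z - z\<^sub>0)) \<le> (1/2) ^ j}
        \<le> (\<Sum>i\<le>I. C * (1/2) ^ (i * k) * of_bool (N i z))" if z: "z \<in> S" for z
    proof -
      have eq: "orth_proj (V \<times> UNIV) (z - z\<^sub>0) = (orth_proj V (fst z - fst z\<^sub>0), snd z - snd z\<^sub>0)"
        if "V \<in> space \<gamma>" for V
        using that \<gamma> orth_proj_Times_UNIV[of V "fst (z - z\<^sub>0)" "snd (z - z\<^sub>0)"]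
        by (simp add: space_grassmann minus_prod_def)
      show ?thesis
      proof (cases "norm (snd z - snd z\<^sub>0) \<le> (1/2) ^ j")
        case True
        have "prob {V\<in>space \<gamma>. norm (orth_proj (V \<times> UNIV) (z - z\<^sub>0)) \<le> (1/2) ^ j}
            \<le> prob {V\<in>space \<gamma>. norm (orth_proj V (fst z - fst z\<^sub>0)) \<le> (1/2) ^ j}"
        proof (rule finite_measure_mono)
          show "{V\<in>space \<gamma>. norm (orth_proj V (fst z - fst z\<^sub>0)) \<le> (1/2) ^ j} \<in> events"
            using measurable_norm_orth_proj[OF \<gamma>, measurable] by measurable
          show "{V\<in>space \<gamma>. norm (orth_proj (V \<times> UNIV) (z - z\<^sub>0)) \<le> (1/2) ^ j}
              \<subseteq> {V\<in>space \<gamma>. norm (orth_proj V (fst z - fst z\<^sub>0)) \<le> (1/2) ^ j}"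
            using order_trans[OF norm_fst_le] by (auto simp: eq)
        qed
        also have "\<dots> \<le> (\<Sum>i\<le>I. C * (1/2) ^ (i * k) * of_bool (norm (fst z - fst z\<^sub>0) \<le> 2 ^ i * (1/2) ^ j))"
        proof (rule C(2))
          have "norm (fst (z - z\<^sub>0)) \<le> norm (z - z\<^sub>0)" by (metis norm_fst_le prod.collapse)
          then show "norm (fst z - fst z\<^sub>0) \<le> 2 ^ I * (1/2) ^ j" using I z by force
        qed
        finally show ?thesis using True by (simp add: N_def)
      next
        case False
        \<comment> \<open>Every projection fixes the second component, so the event occurs for no
          subspace.\<close>
        have "norm (orth_proj (V \<times> UNIV) (z - z\<^sub>0)) > (1/2) ^ j" if "V \<in> space \<gamma>" for V
          using False norm_snd_le[of "snd z - snd z\<^sub>0" "orth_proj V (fst z - fst z\<^sub>0)"] unfolding eq[OF that] by linarith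
        then have empty: "{V\<in>space \<gamma>. norm (orth_proj (V \<times> UNIV) (z - z\<^sub>0)) \<le> (1/2) ^ j} = {}"
          by (auto simp: not_le[symmetric])
        show ?thesis unfolding empty using False C(1) by (simp add: N_def)
      qed
    qed
    have "(\<Sum>z\<in>S. p z * prob {V\<in>space \<gamma>. norm (orth_proj (V \<times> UNIV) (z - z\<^sub>0)) \<le> (1/2) ^ j})
        \<le> (\<Sum>z\<in>S. p z * (\<Sum>i\<le>I. C * (1/2) ^ (i * k) * of_bool (N i z)))"
      using S pr by (intro sum_mono mult_left_mono) auto
    also have "\<dots> = (\<Sum>z\<in>S. \<Sum>i\<le>I. C * (1/2) ^ (i * k) * (p z * of_bool (N i z)))"
      by (simp add: sum_distrib_left mult_ac)
    also have "\<dots> = (\<Sum>i\<le>I. \<Sum>z\<in>S. C * (1/2) ^ (i * k) * (p z * of_bool (N i z)))"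
      by (rule sum.swap)
    also have "\<dots> = (\<Sum>i\<le>I. C * (1/2) ^ (i * k) * (\<Sum>z\<in>{z\<in>S. N i z}. p z))"
    proof (intro sum.cong refl)
      fix i
      have "(\<Sum>z\<in>{z\<in>S. N i z}. p z) = (\<Sum>z\<in>S. p z * of_bool (N i z))"
        unfolding sum.inter_filter[OF S(1)] by (intro sum.cong) auto
      then show "(\<Sum>z\<in>S. C * (1/2) ^ (i * k) * (p z * of_bool (N i z)))
          = C * (1/2) ^ (i * k) * (\<Sum>z\<in>{z\<in>S. N i z}. p z)"
        by (simp add: sum_distrib_left)
    qed
    also have "\<dots> \<le> (\<Sum>i\<le>I. C * (1/2) ^ (i * k) * (K * 2 ^ (i * k) * M))"
      unfolding N_def K_def using S cells C(1)
      by (intro sum_mono mult_left_mono weight_of_slab[OF B]) auto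
    also have "\<dots> = (\<Sum>i\<le>I. C * K * M)"
      by (intro sum.cong refl) (simp add: power_one_over)
    also have "\<dots> = C * K * (real I + 1) * M" by (simp add: algebra_simps)
    finally show ?thesis .
  qed
  moreover have "0 \<le> C * K" using C(1) by (simp add: K_def)
  ultimately show ?thesis by blast
qed

section \<open>Mass distribution along a sequence of discrete measures\<close>

text \<open>For \<tau> > 0 and two points at distance d <= 1, the sum of 2^(\<tau> j) over the j <=
  n with d <= 2^-j is comparable to max(d, 2^-n)^(-\<tau>). This is a dyadic \<tau>-energy cut off
  at scale 2^-n.\<close>

definition truncated_energy ::
    "real \<Rightarrow> ('z \<Rightarrow> 'm::metric_space) \<Rightarrow> nat \<Rightarrow> 'z set \<Rightarrow> ('z \<Rightarrow> real) \<Rightarrow> real"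
  where "truncated_energy \<tau> g n S p = (\<Sum>j\<le>n. 2 powr (\<tau> * real j) *
    (\<Sum>x\<in>S. \<Sum>y\<in>S. p x * p y * of_bool (dist (g x) (g y) \<le> (1/2) ^ j)))"

lemma exists_dyadic_scale:
  assumes "0 < (e::real)" "e \<le> 1"
  obtains j where "(1/2) ^ Suc j < e" "e \<le> (1/2) ^ j"
proof -
  obtain i where i: "(1/2) ^ i < e" using real_arch_pow_inv[of e "1/2"] assms(1) by auto
  define m where "m = (LEAST i. (1/2) ^ i < e)"
  have m: "(1/2) ^ m < e" unfolding m_def using i by (rule LeastI)
  then have "m \<noteq> 0" using assms(2) by (intro notI) simp
  then obtain j where j: "m = Suc j" using not0_implies_Suc by blast
  have "\<not> (1/2) ^ j < e" using not_less_Least[of j "\<lambda>i. (1/2) ^ i < e"] j by (simp add: m_def)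
  then show thesis using that[of j] m j by simp
qed

text \<open>Markov's inequality: the points with \<open>q z > 2 * L\<close> carry at most half of
  the mass.\<close>

lemma sum_low_weight_ge_half:
  fixes p q :: "'z \<Rightarrow> real"
  assumes S: "finite S" "\<And>z. z \<in> S \<Longrightarrow> 0 \<le> p z" "(\<Sum>z\<in>S. p z) = 1"
    and q: "\<And>z. z \<in> S \<Longrightarrow> 0 \<le> q z" "(\<Sum>z\<in>S. p z * q z) \<le> L" and L: "0 < L"
  shows "1/2 \<le> (\<Sum>z\<in>{z\<in>S. q z \<le> 2 * L}. p z)"
proof -
  have "2 * L * (\<Sum>z\<in>S - {z\<in>S. q z \<le> 2 * L}. p z) \<le> (\<Sum>z\<in>S - {z\<in>S. q z \<le> 2 * L}. p z * q z)"
    unfolding sum_distrib_left using S(2) by (intro sum_mono) (auto simp: mult.commute intro: mult_left_mono)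
  also have "\<dots> \<le> (\<Sum>z\<in>S. p z * q z)" using S q by (intro sum_mono2) auto
  finally have "L * (2 * (\<Sum>z\<in>S - {z\<in>S. q z \<le> 2 * L}. p z)) \<le> L * 1"
    using q(2) by (simp only: mult_1_right mult_ac)
  then have "(\<Sum>z\<in>S - {z\<in>S. q z \<le> 2 * L}. p z) \<le> 1/2"
    using mult_left_le_imp_le[OF _ L] by fastforce
  moreover have "(\<Sum>z\<in>S - {z\<in>S. q z \<le> 2 * L}. p z) + (\<Sum>z\<in>{z\<in>S. q z \<le> 2 * L}. p z) = 1"
    using S(1,3) by (subst sum.subset_diff[symmetric]) auto
  ultimately show ?thesis by linarith
qed

text \<open>Prepares a covering set for compactness and for a choice of dyadic scale: the
  enlargement is open and its size \<open>e\<close> is positive even if \<open>U\<close> is a point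
  or empty. As the diameter is below 1, its \<tau>-th power is at most its s-th power; \<eta> pays
  for the enlargement.\<close>

lemma enlarge_cover_member:
  fixes U :: "'m::metric_space set"
  assumes \<tau>: "0 < \<tau>" and s: "0 \<le> s" "s < \<tau>" and \<eta>: "0 < \<eta>"
    and U: "bounded U" "diameter U \<le> 1/2"
  obtains e Q where "0 < e" "e \<le> 1" "ennreal (e powr \<tau>) \<le> diam_power s U + ennreal \<eta>"
    "open Q" "U \<subseteq> Q" "\<And>x y. x \<in> Q \<Longrightarrow> y \<in> Q \<Longrightarrow> dist x y < e"
proof -
  define d where "d = diameter U"
  have d: "0 \<le> d" "d \<le> 1/2" using U diameter_ge_0[of U] by (auto simp: d_def)
  have "((\<lambda>e. e powr \<tau>) \<longlongrightarrow> d powr \<tau>) (at_right d)"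
    using \<tau> d(1) by (intro tendsto_powr' tendsto_const tendsto_ident_at disjI2 conjI)
      (auto intro: eventually_mono[OF eventually_at_right_less[of d]])
  then have "eventually (\<lambda>e. e powr \<tau> < d powr \<tau> + \<eta>) (at_right d)"
    using \<eta> by (intro order_tendstoD) auto
  moreover have "eventually (\<lambda>e. e \<in> {d<..<1}) (at_right d)"
    using d(2) by (intro eventually_at_rightI[of d 1]) auto
  ultimately have "eventually (\<lambda>e. e powr \<tau> < d powr \<tau> + \<eta> \<and> e \<in> {d<..<1}) (at_right d)"
    by (rule eventually_conj)
  then obtain e where e: "e powr \<tau> < d powr \<tau> + \<eta>" "d < e" "e < 1"
    using eventually_happens[of _ "at_right d"] by auto
  show thesis
  proof (cases "U = {}")
    case True
    then have "d = 0" by (simp add: d_def diameter_def)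
    then have "ennreal (e powr \<tau>) \<le> diam_power s U + ennreal \<eta>"
      using e(1) \<tau> True by (auto simp: diam_power_def intro!: ennreal_leI)
    then show thesis using that[of e "{}"] e d True by auto
  next
    case False
    have dp: "ennreal (d powr \<tau>) \<le> diam_power s U"
    proof (cases "s = 0")
      case True
      \<comment> \<open>For exponent 0 a nonempty set costs 1 whatever its diameter.\<close>
      have "d powr \<tau> \<le> 1 powr \<tau>" using d \<tau> by (intro powr_mono2) auto
      then show ?thesis using True False by (simp add: diam_power_def)
    next
      case s0: False
      have "d powr \<tau> \<le> d powr s"
        using d s by (cases "d = 0") (auto intro: powr_mono')
      then show ?thesis using s0 False by (simp add: diam_power_def d_def ennreal_leI)
    qed
    have "ennreal (e powr \<tau>) \<le> ennreal (d powr \<tau>) + ennreal \<eta>"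
      using e(1) \<eta> by (simp add: ennreal_leI flip: ennreal_plus)
    also have "\<dots> \<le> diam_power s U + ennreal \<eta>" using dp by (rule add_right_mono)
    finally have 1: "ennreal (e powr \<tau>) \<le> diam_power s U + ennreal \<eta>" .
    define Q where "Q = (\<Union>u\<in>U. ball u ((e - d) / 2))"
    have 2: "dist x y < e" if xy: "x \<in> Q" "y \<in> Q" for x y
    proof -
      obtain u v where uv: "u \<in> U" "v \<in> U" "dist u x < (e - d) / 2" "dist v y < (e - d) / 2"
        using xy by (auto simp: Q_def)
      have "dist u v \<le> d" unfolding d_def using U(1) uv by (intro diameter_bounded_bound)
      moreover have "dist x y \<le> dist u x + dist u v + dist v y"
        using dist_triangle[of x y u] dist_triangle[of u y v] by (simp add: dist_commute)
      moreover have "dist u x + dist v y < e - d"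
        using add_strict_mono[OF uv(3,4)] by simp
      ultimately show ?thesis by linarith
    qed
    have "open Q" "U \<subseteq> Q" using e(2) by (auto simp: Q_def)
    then show thesis using that[of e Q] e d 1 2 by auto
  qed
qed

text \<open>Mass distribution, by contradiction from a cheap cover. Finitely many enlarged members
  cover the compact box, hence the support \<open>S n\<close> for large n. Points of low truncated
  potential carry half of the mass, yet a member of size e carries at most a constant times e^\<tau>
  of that half, which sums to too little.\<close>

lemma hausdorff_dim_ge_of_bounded_energy:
  fixes f :: "(nat \<Rightarrow> nat) \<Rightarrow> 'z::topological_space" and g :: "'z \<Rightarrow> 'm::metric_space"
  assumes \<tau>: "0 < \<tau>" and cont: "continuous_on UNIV f" "continuous_on UNIV g"
    and S: "\<And>n. finite (S n)" "\<And>n. S n \<subseteq> f ` {x. \<forall>i<n. x i \<le> \<nu> i}"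
      "\<And>n z. z \<in> S n \<Longrightarrow> 0 \<le> p n z" "\<And>n. (\<Sum>z\<in>S n. p n z) = 1"
    and energy: "\<exists>\<^sub>F n in sequentially. truncated_energy \<tau> g n (S n) (p n) \<le> L"
  shows "ennreal \<tau> \<le> hausdorff_dim (g ` range f)"
  unfolding hausdorff_dim_def
proof (rule INF_greatest, rule ccontr)
  fix s assume "s \<in> {s. 0 \<le> s \<and> hausdorff_measure s (g ` range f) = 0}" "\<not> ennreal \<tau> \<le> ennreal s"
  then have s: "0 \<le> s" "s < \<tau>" and zero: "hausdorff_measure s (g ` range f) = 0"
    by (auto simp: not_le ennreal_less_iff)
  define M where "M = max 1 L"
  have M: "0 < M" "L \<le> M" by (auto simp: M_def)
  \<comment> \<open>The members will carry at most 2 M 2^\<tau> times 2 \<epsilon>, that is 1/4,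
    against a mass of 1/2. Rounding sizes to powers of 2 costs 2^\<tau>, and enlarging the cover
    doubles \<epsilon>.\<close>
  define \<epsilon> where "\<epsilon> = 1 / (16 * M * 2 powr \<tau>)"
  have \<epsilon>: "0 < \<epsilon>" using M by (simp add: \<epsilon>_def)
  have "hausdorff_premeasure s (1/2) (g ` range f) \<le> hausdorff_measure s (g ` range f)"
    unfolding hausdorff_measure_def by (rule SUP_upper) simp
  then have "hausdorff_premeasure s (1/2) (g ` range f) < ennreal \<epsilon>" using zero \<epsilon> by simp
  then obtain U where U: "g ` range f \<subseteq> (\<Union>i. U i)" "\<And>i::nat. bounded (U i)" "\<And>i. diameter (U i) \<le> 1/2"
      "(\<Sum>i. diam_power s (U i)) < ennreal \<epsilon>"
    unfolding hausdorff_premeasure_def INF_less_iff by auto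
  have "\<exists>e Q. 0 < e \<and> e \<le> 1 \<and> ennreal (e powr \<tau>) \<le> diam_power s (U i) + ennreal (\<epsilon> * (1/2) ^ Suc i) \<and>
    open Q \<and> U i \<subseteq> Q \<and> (\<forall>x\<in>Q. \<forall>y\<in>Q. dist x y < e)" for i
    by (rule enlarge_cover_member[OF \<tau> s _ U(2)[of i] U(3)[of i], of "\<epsilon> * (1/2) ^ Suc i"])
      (use \<epsilon> in simp, blast)
  then obtain e Q where e: "\<And>i. 0 < e i" "\<And>i. e i \<le> 1"
      "\<And>i. ennreal (e i powr \<tau>) \<le> diam_power s (U i) + ennreal (\<epsilon> * (1/2) ^ Suc i)"
    and Q: "\<And>i. open (Q i)" "\<And>i. U i \<subseteq> Q i" "\<And>i x y. x \<in> Q i \<Longrightarrow> y \<in> Q i \<Longrightarrow> dist x y < e i"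
    by metis
  have "\<exists>j. (1/2) ^ Suc j < e i \<and> e i \<le> (1/2) ^ j" for i
    using exists_dyadic_scale[OF e(1,2)] by metis
  then obtain J where J: "\<And>i. (1/2) ^ Suc (J i) < e i" "\<And>i. e i \<le> (1/2) ^ J i" by metis
  have "ennreal (\<Sum>i<m. e i powr \<tau>) \<le> ennreal (2 * \<epsilon>)" for m
  proof -
    have "ennreal (\<Sum>i<m. e i powr \<tau>) = (\<Sum>i<m. ennreal (e i powr \<tau>))" by (simp add: sum_ennreal)
    also have "\<dots> \<le> (\<Sum>i<m. diam_power s (U i)) + (\<Sum>i<m. ennreal (\<epsilon> * (1/2) ^ Suc i))"
      unfolding sum.distrib[symmetric] by (intro sum_mono e)
    also have "\<dots> \<le> ennreal \<epsilon> + ennreal \<epsilon>"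
    proof (rule add_mono)
      show "(\<Sum>i<m. diam_power s (U i)) \<le> ennreal \<epsilon>"
        using U(4) sum_le_suminf[of "\<lambda>i. diam_power s (U i)" "{..<m}"] by (simp add: summableI)
      have "(\<Sum>i<m. (1/2::real) ^ Suc i) \<le> 1"
        using sum_le_suminf[OF sums_summable[OF power_half_series], of "{..<m}"]
          sums_unique[OF power_half_series] by simp
      then have "\<epsilon> * (\<Sum>i<m. (1/2::real) ^ Suc i) \<le> \<epsilon>" using \<epsilon> mult_left_le by force
      then show "(\<Sum>i<m. ennreal (\<epsilon> * (1/2) ^ Suc i)) \<le> ennreal \<epsilon>"
        using \<epsilon> by (subst sum_ennreal) (auto simp: sum_distrib_left intro!: ennreal_leI)
    qed
    also have "\<dots> = ennreal (2 * \<epsilon>)" using \<epsilon> by (simp flip: ennreal_plus)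
    finally show ?thesis .
  qed
  then have sum_e: "(\<Sum>i<m. e i powr \<tau>) \<le> 2 * \<epsilon>" for m
    using \<epsilon> by (simp add: ennreal_le_iff)
  define G where "G i = (g \<circ> f) -` Q i" for i
  have G: "open (G i)" for i
  proof -
    have "continuous_on UNIV (g \<circ> f)"
      using cont by (intro continuous_on_compose) (auto intro: continuous_on_subset)
    then show ?thesis unfolding G_def using Q(1) by (simp add: open_vimage)
  qed
  have cover: "{x. \<forall>i. x i \<le> \<nu> i} \<subseteq> (\<Union>i\<in>UNIV. G i)"
  proof clarify
    fix x :: "nat \<Rightarrow> nat"
    have "g (f x) \<in> (\<Union>i. U i)" using U(1) by blast
    then obtain i where "g (f x) \<in> U i" by blast
    then show "x \<in> (\<Union>i\<in>UNIV. G i)" using Q(2)[of i] by (auto simp: G_def)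
  qed
  obtain I where I: "finite I" "{x. \<forall>i. x i \<le> \<nu> i} \<subseteq> (\<Union>i\<in>I. G i)"
    by (rule compactE_image[OF compact_nat_box G cover]) blast
  obtain m where m: "I \<subseteq> {..<m}" using I(1) finite_nat_bounded by auto
  have "open (\<Union>i<m. G i)" "{x. \<forall>i. x i \<le> \<nu> i} \<subseteq> (\<Union>i<m. G i)"
    using G order_trans[OF I(2) UN_mono[OF m order_refl]] by blast+
  then obtain j\<^sub>0 where j0: "{x. \<forall>i<j\<^sub>0. x i \<le> \<nu> i} \<subseteq> (\<Union>i<m. G i)"
    by (rule truncation_subset_open)
  \<comment> \<open>\<open>n\<close> is at least \<open>j\<^sub>0\<close>, so that the support is
    covered, and at least every \<open>J i\<close>, so that all scales of the cover occur in the
    energy. One such \<open>n\<close> suffices, so a bound along a subsequence is enough.\<close>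
  obtain n where n: "max j\<^sub>0 (Max (insert 0 (J ` {..<m}))) \<le> n" "truncated_energy \<tau> g n (S n) (p n) \<le> L"
    using energy unfolding frequently_sequentially by blast
  have n': "j\<^sub>0 \<le> n" "\<And>i. i < m \<Longrightarrow> J i \<le> n"
  proof -
    show "j\<^sub>0 \<le> n" using n(1) by simp
    fix i assume "i < m"
    then show "J i \<le> n" using n(1) by simp
  qed
  define near where "near j x = (\<Sum>y\<in>S n. p n y * of_bool (dist (g x) (g y) \<le> (1/2) ^ j))" for j x
  \<comment> \<open>The truncated potential at \<open>x\<close>; its mean under \<open>p n\<close>
    is the energy.\<close>
  define q where "q x = (\<Sum>j\<le>n. 2 powr (\<tau> * real j) * near j x)" for x
  have near0: "0 \<le> near j x" for j x
    unfolding near_def using S(3) by (intro sum_nonneg) auto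
  have q0: "0 \<le> q x" for x unfolding q_def using near0 by (intro sum_nonneg) auto
  have "(\<Sum>x\<in>S n. p n x * q x) = truncated_energy \<tau> g n (S n) (p n)"
    unfolding q_def near_def truncated_energy_def sum_distrib_left
    by (subst sum.swap) (simp add: mult_ac)
  then have pq: "(\<Sum>x\<in>S n. p n x * q x) \<le> M" using n(2) M(2) by simp
  define H where "H = {x\<in>S n. q x \<le> 2 * M}"
  have "1/2 \<le> (\<Sum>x\<in>H. p n x)"
    unfolding H_def by (rule sum_low_weight_ge_half[OF S(1,3,4) q0 pq M(1)])
  also have "\<dots> \<le> (\<Sum>i<m. \<Sum>x\<in>{x\<in>H. g x \<in> Q i}. p n x)"
  proof -
    have "p n x \<le> (\<Sum>i<m. p n x * of_bool (g x \<in> Q i))" if x: "x \<in> H" for x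
    proof -
      obtain a where a: "x = f a" "\<forall>i<n. a i \<le> \<nu> i" using S(2)[of n] x by (auto simp: H_def)
      then have "a \<in> {x. \<forall>i<j\<^sub>0. x i \<le> \<nu> i}" using n'(1) by auto
      then obtain i where i: "i < m" "a \<in> G i" using j0 by blast
      then have "p n x = p n x * of_bool (g x \<in> Q i)" using a by (simp add: G_def)
      also have "\<dots> \<le> (\<Sum>i<m. p n x * of_bool (g x \<in> Q i))"
        using i(1) x S(3) by (intro member_le_sum) (auto simp: H_def)
      finally show ?thesis .
    qed
    then have "(\<Sum>x\<in>H. p n x) \<le> (\<Sum>x\<in>H. \<Sum>i<m. p n x * of_bool (g x \<in> Q i))"
      by (rule sum_mono)
    also have "\<dots> = (\<Sum>i<m. \<Sum>x\<in>H. p n x * of_bool (g x \<in> Q i))" by (rule sum.swap)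
    also have "\<dots> = (\<Sum>i<m. \<Sum>x\<in>{x\<in>H. g x \<in> Q i}. p n x)"
    proof (rule sum.cong[OF refl])
      fix i
      have "finite H" using S(1) by (simp add: H_def)
      then show "(\<Sum>x\<in>H. p n x * of_bool (g x \<in> Q i)) = (\<Sum>x\<in>{x\<in>H. g x \<in> Q i}. p n x)"
        unfolding sum.inter_filter[OF \<open>finite H\<close>] by (intro sum.cong) auto
    qed
    finally show ?thesis .
  qed
  also have "\<dots> \<le> (\<Sum>i<m. 2 * M * 2 powr \<tau> * e i powr \<tau>)"
  proof (rule sum_mono)
    fix i assume i: "i \<in> {..<m}"
    show "(\<Sum>x\<in>{x\<in>H. g x \<in> Q i}. p n x) \<le> 2 * M * 2 powr \<tau> * e i powr \<tau>"
    proof (cases "{x\<in>H. g x \<in> Q i} = {}")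
      case True
      show ?thesis unfolding True using M by simp
    next
      case False
      \<comment> \<open>All points of this piece are within 2^-J of the low-potential point
        \<open>x\<close>, so one term of \<open>q x\<close> bounds their mass.\<close>
      then obtain x where x: "x \<in> H" "g x \<in> Q i" by auto
      have "(\<Sum>x\<in>{x\<in>H. g x \<in> Q i}. p n x) \<le> near (J i) x"
      proof -
        have "(\<Sum>y\<in>{x\<in>H. g x \<in> Q i}. p n y)
            = (\<Sum>y\<in>{x\<in>H. g x \<in> Q i}. p n y * of_bool (dist (g x) (g y) \<le> (1/2) ^ J i))"
        proof (rule sum.cong[OF refl])
          fix y assume "y \<in> {x\<in>H. g x \<in> Q i}"
          then have "dist (g x) (g y) \<le> (1/2) ^ J i" using Q(3)[OF x(2), of "g y"] J(2)[of i] by simp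
          then show "p n y = p n y * of_bool (dist (g x) (g y) \<le> (1/2) ^ J i)" by simp
        qed
        also have "\<dots> \<le> near (J i) x"
          unfolding near_def using S(1,3) by (intro sum_mono2) (auto simp: H_def)
        finally show ?thesis .
      qed
      also have "near (J i) x \<le> 2 * M * 2 powr (- \<tau> * real (J i))"
      proof -
        have "2 powr (\<tau> * real (J i)) * near (J i) x \<le> q x"
          unfolding q_def using n'(2) i near0
          by (intro member_le_sum[of "J i" "{..n}" "\<lambda>j. 2 powr (\<tau> * real j) * near j x"]) auto
        also have "\<dots> \<le> 2 * M" using x(1) by (simp add: H_def)
        finally show ?thesis by (simp add: powr_minus field_simps)
      qed
      also have "2 powr (- \<tau> * real (J i)) = (2 * (1/2) ^ Suc (J i)) powr \<tau>"
        by (simp add: powr_realpow[symmetric] powr_powr powr_minus_divide powr_divide power_one_over mult.commute)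
      also have "\<dots> \<le> (2 * e i) powr \<tau>" using J(1)[of i] \<tau> by (intro powr_mono2) auto
      also have "\<dots> = 2 powr \<tau> * e i powr \<tau>" using e(1)[of i] by (simp add: powr_mult)
      finally show ?thesis using M by (simp add: mult.assoc)
    qed
  qed
  also have "\<dots> \<le> 2 * M * 2 powr \<tau> * (2 * \<epsilon>)"
    unfolding sum_distrib_left[symmetric] using M sum_e by (intro mult_left_mono) auto
  also have "\<dots> = 1/4" using M by (simp add: \<epsilon>_def)
  finally show False by simp
qed

section \<open>Almost every projection is at least as large as a given one\<close>

text \<open>For fixed \<open>S\<close> and \<open>p\<close>, the energy is a finite combination of
  indicators of events. Writing the differences as \<open>y - x\<close> gives the inner sum the form
  of \<open>expected_weight_near\<close> with centre \<open>x\<close>.\<close>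

lemma nn_integral_truncated_energy:
  fixes \<gamma> :: "(real ^ 'p) set measure"
    and S :: "((real ^ 'p) \<times> 'b::euclidean_space) set"
  assumes \<gamma>: "is_grassmann_measure k \<gamma>" and S: "finite S" "\<And>z. z \<in> S \<Longrightarrow> 0 \<le> p z"
  shows "(\<integral>\<^sup>+V. ennreal (truncated_energy \<tau> (orth_proj (V \<times> UNIV)) n S p) \<partial>\<gamma>)
    = ennreal (\<Sum>j\<le>n. 2 powr (\<tau> * real j) * (\<Sum>x\<in>S. p x * (\<Sum>y\<in>S. p y *
        measure \<gamma> {V\<in>space \<gamma>. norm (orth_proj (V \<times> UNIV) (y - x)) \<le> (1/2) ^ j})))"
    and "(\<lambda>V. ennreal (truncated_energy \<tau> (orth_proj (V \<times> UNIV)) n S p)) \<in> borel_measurable \<gamma>"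
proof -
  interpret prob_space \<gamma> using \<gamma> by (simp add: is_grassmann_measure_def)
  define E where "E j x y = {V\<in>space \<gamma>. norm (orth_proj (V \<times> UNIV) (y - x)) \<le> (1/2) ^ j}"
    for j :: nat and x y :: "(real ^ 'p) \<times> 'b"
  have E [measurable]: "E j x y \<in> events" for j x y
  proof -
    have "E j x y = {V\<in>space \<gamma>.
        sqrt ((norm (orth_proj V (fst (y - x))))\<^sup>2 + (norm (snd (y - x)))\<^sup>2) \<le> (1/2) ^ j}"
    proof -
      have "orth_proj (V \<times> UNIV) (y - x) = (orth_proj V (fst (y - x)), snd (y - x))"
        if "V \<in> space \<gamma>" for V
        using that \<gamma> orth_proj_Times_UNIV[of V "fst (y - x)" "snd (y - x)"]
        by (simp add: space_grassmann minus_prod_def)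
      then show ?thesis by (auto simp: E_def norm_Pair)
    qed
    then show ?thesis using measurable_norm_orth_proj[OF \<gamma>, measurable] by simp
  qed
  define T where "T = {..n} \<times> S \<times> S"
  define a where "a = (\<lambda>(j, x, y). 2 powr (\<tau> * real j) * (p x * p y))"
  define F where "F = (\<lambda>(j, x, y). E j x y)"
  have T: "finite T" "\<And>t. t \<in> T \<Longrightarrow> 0 \<le> a t" using S by (auto simp: T_def a_def)
  have F [measurable]: "F t \<in> events" for t by (simp add: F_def split_def)
  have eq: "ennreal (truncated_energy \<tau> (orth_proj (V \<times> UNIV)) n S p)
      = (\<Sum>t\<in>T. ennreal (a t) * indicator (F t) V)" if V: "V \<in> space \<gamma>" for V
  proof -
    have "subspace (V \<times> (UNIV :: 'b set))" using V \<gamma> by (simp add: space_grassmann subspace_Times)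
    then have d: "dist (orth_proj (V \<times> UNIV) x) (orth_proj (V \<times> UNIV) y)
        = norm (orth_proj (V \<times> UNIV) (y - x))" for x y :: "(real ^ 'p) \<times> 'b"
      by (simp add: dist_norm norm_minus_commute linear_diff[OF linear_orth_proj])
    have "truncated_energy \<tau> (orth_proj (V \<times> UNIV)) n S p
        = (\<Sum>j\<le>n. \<Sum>x\<in>S. \<Sum>y\<in>S. 2 powr (\<tau> * real j) * (p x * p y) * indicator (E j x y) V)"
      unfolding truncated_energy_def sum_distrib_left
      by (intro sum.cong refl) (auto simp: d E_def V indicator_def)
    also have "\<dots> = (\<Sum>t\<in>T. a t * indicator (F t) V)"
      by (simp add: sum.cartesian_product T_def a_def F_def split_def)
    also have "ennreal \<dots> = (\<Sum>t\<in>T. ennreal (a t * indicator (F t) V))"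
      using T(2) by (intro sum_ennreal[symmetric]) simp
    also have "\<dots> = (\<Sum>t\<in>T. ennreal (a t) * indicator (F t) V)"
      by (intro sum.cong refl) (simp split: split_indicator)
    finally show ?thesis .
  qed
  show "(\<lambda>V. ennreal (truncated_energy \<tau> (orth_proj (V \<times> UNIV)) n S p)) \<in> borel_measurable \<gamma>"
    by (subst measurable_cong[OF eq]) (assumption, measurable)
  have "(\<integral>\<^sup>+V. ennreal (truncated_energy \<tau> (orth_proj (V \<times> UNIV)) n S p) \<partial>\<gamma>)
      = (\<integral>\<^sup>+V. (\<Sum>t\<in>T. ennreal (a t) * indicator (F t) V) \<partial>\<gamma>)"
    by (rule nn_integral_cong[OF eq])
  also have "\<dots> = (\<Sum>t\<in>T. ennreal (a t) * emeasure \<gamma> (F t))"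
    by (simp add: nn_integral_sum nn_integral_cmult_indicator)
  also have "\<dots> = (\<Sum>t\<in>T. ennreal (a t * prob (F t)))"
    using T(2) by (intro sum.cong refl) (simp add: emeasure_eq_measure ennreal_mult)
  also have "\<dots> = ennreal (\<Sum>t\<in>T. a t * prob (F t))"
    using T(2) by (intro sum_ennreal) simp
  also have "(\<Sum>t\<in>T. a t * prob (F t))
    = (\<Sum>j\<le>n. \<Sum>x\<in>S. \<Sum>y\<in>S. 2 powr (\<tau> * real j) * (p x * p y) * prob (E j x y))"
    by (simp add: sum.cartesian_product T_def a_def F_def split_def)
  also have "\<dots> = (\<Sum>j\<le>n. 2 powr (\<tau> * real j) * (\<Sum>x\<in>S. p x * (\<Sum>y\<in>S. p y * prob (E j x y))))"
    unfolding sum_distrib_left by (intro sum.cong refl) (simp add: mult_ac)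
  finally show "(\<integral>\<^sup>+V. ennreal (truncated_energy \<tau> (orth_proj (V \<times> UNIV)) n S p) \<partial>\<gamma>)
    = ennreal (\<Sum>j\<le>n. 2 powr (\<tau> * real j) * (\<Sum>x\<in>S. p x * (\<Sum>y\<in>S. p y *
        measure \<gamma> {V\<in>space \<gamma>. norm (orth_proj (V \<times> UNIV) (y - x)) \<le> (1/2) ^ j})))"
    unfolding E_def .
qed

lemma summable_linear_times_geometric:
  fixes q :: real
  assumes "0 \<le> q" "q < 1" shows "summable (\<lambda>j. (real j + c) * q ^ j)"
proof -
  have "summable (\<lambda>j. real (Suc j) * q ^ j)"
    using geometric_deriv_sums[of q] assms by (auto intro: sums_summable)
  moreover have "summable (\<lambda>j. (c - 1) * q ^ j)"
    using assms by (intro summable_mult summable_geometric) simp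
  ultimately have "summable (\<lambda>j. real (Suc j) * q ^ j + (c - 1) * q ^ j)" by (rule summable_add)
  then show ?thesis by (simp add: algebra_simps)
qed

text \<open>By Fatou the lower limit has finite integral, hence is finite almost everywhere. Both
  \<open>L\<close> and the indices \<open>n\<close> depend on the point.\<close>

lemma AE_liminf_finite:
  assumes "\<And>n. u n \<in> borel_measurable M" "\<And>n. (\<integral>\<^sup>+x. u n x \<partial>M) \<le> ennreal K"
  shows "AE x in M. \<exists>L::real. \<exists>\<^sub>F n in sequentially. u n x \<le> ennreal L"
proof -
  have "(\<integral>\<^sup>+x. liminf (\<lambda>n. u n x) \<partial>M) \<le> liminf (\<lambda>n. \<integral>\<^sup>+x. u n x \<partial>M)"
    using assms(1) by (rule nn_integral_liminf)
  also have "\<dots> \<le> ennreal K"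
    by (intro Liminf_le) (auto simp: assms)
  finally have "(\<integral>\<^sup>+x. liminf (\<lambda>n. u n x) \<partial>M) \<noteq> \<infinity>" by (auto simp: top_unique)
  moreover have "(\<lambda>x. liminf (\<lambda>n. u n x)) \<in> borel_measurable M" using assms(1) by measurable
  ultimately have "AE x in M. liminf (\<lambda>n. u n x) \<noteq> \<infinity>" by (rule nn_integral_PInf_AE[rotated])
  then show ?thesis
  proof eventually_elim
    case (elim x)
    obtain l where "liminf (\<lambda>n. u n x) = ennreal l" "0 \<le> l"
      using elim by (cases "liminf (\<lambda>n. u n x)") auto
    then have l: "liminf (\<lambda>n. u n x) < ennreal (l + 1)"
      by (simp add: ennreal_less_iff)
    have "\<not> eventually (\<lambda>n. ennreal (l + 1) < u n x) sequentially"
    proof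
      assume "eventually (\<lambda>n. ennreal (l + 1) < u n x) sequentially"
      then have "ennreal (l + 1) \<le> liminf (\<lambda>n. u n x)"
        by (intro Liminf_bounded) (auto elim: eventually_mono)
      with l show False by simp
    qed
    then show ?case by (auto simp: frequently_def not_le intro!: exI[of _ "l + 1"])
  qed
qed

lemma AE_hausdorff_dim_proj_image_ge:
  fixes \<gamma> :: "(real ^ 'p) set measure" and B :: "((real ^ 'p) \<times> 'b::euclidean_space) set"
  assumes \<gamma>: "is_grassmann_measure k \<gamma>" and B: "analytic_set B"
    and W: "W \<in> grassmannian k" and \<tau>: "0 < \<tau>" "ennreal \<tau> < hausdorff_dim (proj_image B W)"
  shows "AE V in \<gamma>. ennreal \<tau> \<le> hausdorff_dim (proj_image B V)"
proof -
  interpret prob_space \<gamma> using \<gamma> by (simp add: is_grassmann_measure_def)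
  \<comment> \<open>The weights are built for an exponent above \<tau>; the gap makes the series of
    j 2^((\<tau> - s) j) converge.\<close>
  obtain s' where "ennreal \<tau> < s'" "s' < hausdorff_dim (proj_image B W)"
    using dense[OF \<tau>(2)] by blast
  then obtain s where s: "\<tau> < s" "ennreal s < hausdorff_dim (proj_image B W)"
    using \<tau>(1) by (cases s') (auto simp: ennreal_less_iff top_unique)
  have W': "subspace W" "dim W = k" using W by (auto simp: grassmannian_def)
  obtain A where A: "orthonormal_basis A W" "card A = k"
    using exists_orthonormal_basis[OF W'(1)] W'(2) by metis
  define D :: "((real ^ 'p) \<times> 'b) set" where "D = product_basis A"
  have D: "orthonormal_basis D (W \<times> UNIV)"
    unfolding D_def using A(1) by (rule orthonormal_basis_product)
  define w :: real where "w = 2 powr - s"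
  have w: "0 < w" by (simp add: w_def)
  interpret refining_partitions "grid_cell D" w by (rule refining_partitions_grid_cell[OF w])
  have "cell_content B \<noteq> 0"
  proof
    assume zero: "cell_content B = 0"
    have "hausdorff_measure s (proj_image B W) = 0"
      unfolding proj_image_def
    proof (rule hausdorff_measure_eq_0I[where c="grid_cell D" and N="real (card D)"])
      show "0 < s" using \<tau>(1) s(1) by simp
      show "refining_partitions (grid_cell D) (2 powr - s)" by (rule refining_partitions_grid_cell) simp
      show "refining_partitions.cell_content (grid_cell D) (2 powr - s) B = 0"
        using zero by (simp add: w_def)
    qed (use norm_orth_proj_le_cell[OF D] in \<open>simp add: dist_norm\<close>)
    then have "hausdorff_dim (proj_image B W) \<le> ennreal s"
      unfolding hausdorff_dim_def using \<tau>(1) s(1) by (intro INF_lower) auto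
    with s(2) show False by simp
  qed
  then obtain \<kappa>' where "0 < \<kappa>'" "\<kappa>' < cell_content B"
    using dense[of 0 "cell_content B"] by (auto simp: zero_less_iff_neq_zero)
  then obtain \<kappa> where \<kappa>: "0 < \<kappa>" "ennreal \<kappa> < cell_content B"
    by (cases \<kappa>') (auto simp: top_unique)
  have "B \<noteq> {}" using \<kappa> cell_content_empty by auto
  then obtain f :: "(nat \<Rightarrow> nat) \<Rightarrow> (real ^ 'p) \<times> 'b" where f: "continuous_on UNIV f" "B = range f"
    using B by (auto simp: analytic_set_def)
  \<comment> \<open>A bounded piece of \<open>B\<close> already has content above \<kappa>.
    Boundedness leaves finitely many cells at each level and limits the number of dyadic
    sizes.\<close>
  have "\<exists>c\<^sub>0. ennreal \<kappa> < cell_content (f ` {x. norm (f x) \<le> 2 ^ c\<^sub>0})"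
  proof (rule ccontr)
    assume "\<nexists>c\<^sub>0. ennreal \<kappa> < cell_content (f ` {x. norm (f x) \<le> 2 ^ c\<^sub>0})"
    then have "cell_content (\<Union>c\<^sub>0. f ` {x. norm (f x) \<le> 2 ^ c\<^sub>0}) \<le> ennreal \<kappa>"
    proof (intro cell_content_incseq incseq_SucI image_mono)
      show "{x. norm (f x) \<le> 2 ^ n} \<subseteq> {x. norm (f x) \<le> 2 ^ Suc n}" for n :: nat
      proof clarify
        fix x assume "norm (f x) \<le> 2 ^ n"
        also have "\<dots> \<le> 2 ^ Suc n" by simp
        finally show "norm (f x) \<le> 2 ^ Suc n" .
      qed
    qed (simp add: not_less)
    moreover have "(\<Union>c\<^sub>0. f ` {x. norm (f x) \<le> 2 ^ c\<^sub>0}) = B"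
    proof -
      have "\<exists>c\<^sub>0. norm (f x) \<le> 2 ^ c\<^sub>0" for x
        using real_arch_pow[of 2 "norm (f x)"] by (auto intro: less_imp_le)
      then show ?thesis unfolding f(2) by blast
    qed
    ultimately show False using \<kappa>(2) by simp
  qed
  then obtain c\<^sub>0 where c0: "ennreal \<kappa> < cell_content (f ` {x. norm (f x) \<le> 2 ^ c\<^sub>0})" by blast
  obtain \<nu> :: "nat \<Rightarrow> nat" where \<nu>: "\<And>j. ennreal \<kappa> <
      cell_content (f ` {x\<in>{x. norm (f x) \<le> 2 ^ c\<^sub>0}. \<forall>i<j. x i \<le> \<nu> i})"
    by (rule cell_content_compact_truncation[OF c0]) blast
  define X where "X n = f ` {x\<in>{x. norm (f x) \<le> 2 ^ c\<^sub>0}. \<forall>i<n. x i \<le> \<nu> i}" for n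
  define good where "good n S p \<longleftrightarrow> finite S \<and> S \<subseteq> X n \<and> (\<forall>z\<in>S. 0 \<le> p z) \<and> (\<Sum>z\<in>S. p z) = 1 \<and>
    (\<forall>i\<le>n. \<forall>a. (\<Sum>z\<in>{z\<in>S. grid_cell D i z = a}. p z) \<le> w ^ i / \<kappa>)"
    for n S and p :: "(real ^ 'p) \<times> 'b \<Rightarrow> real"
  have "\<exists>S p. good n S p" for n
  proof -
    have "bounded (X n)" by (auto simp: bounded_iff X_def)
    moreover have "finite D" using D by (simp add: orthonormal_basis_def)
    ultimately have fin: "finite (grid_cell D i ` X n)" for i by (intro finite_grid_cells_bounded)
    show ?thesis
    proof (rule exists_frostman_weights[where n=n, OF fin \<kappa>(1) \<nu>[of n, folded X_def]])
      fix S and p :: "(real ^ 'p) \<times> 'b \<Rightarrow> real"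
      assume "finite S" "S \<subseteq> X n" "\<And>z. z \<in> S \<Longrightarrow> 0 \<le> p z" "(\<Sum>z\<in>S. p z) = 1"
        "\<And>i a. i \<le> n \<Longrightarrow> (\<Sum>z\<in>{z\<in>S. grid_cell D i z = a}. p z) \<le> w ^ i / \<kappa>"
      then have "good n S p" by (simp add: good_def)
      then show "\<exists>S p. good n S p" by blast
    qed
  qed
  then obtain S p where good: "\<And>n. good n (S n) (p n)" by metis
  have S: "finite (S n)" "S n \<subseteq> X n" "z \<in> S n \<Longrightarrow> 0 \<le> p n z" "(\<Sum>z\<in>S n. p n z) = 1"
    "i \<le> n \<Longrightarrow> (\<Sum>z\<in>{z\<in>S n. grid_cell D i z = a}. p n z) \<le> w ^ i / \<kappa>" for n z i a
    using good[of n] by (auto simp: good_def)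
  obtain C where C: "0 \<le> C \<and> (\<forall>B W (S :: ((real ^ 'p) \<times> 'b) set) p j M I z\<^sub>0.
    orthonormal_basis B W \<longrightarrow> card B = k \<longrightarrow> finite S \<longrightarrow> (\<forall>z\<in>S. 0 \<le> p z) \<longrightarrow>
    (\<forall>a. (\<Sum>z\<in>{z\<in>S. grid_cell (product_basis B) j z = a}. p z) \<le> M) \<longrightarrow>
    (\<forall>z\<in>S. norm (z - z\<^sub>0) \<le> 2 ^ I * (1/2) ^ j) \<longrightarrow>
    (\<Sum>z\<in>S. p z * measure \<gamma> {V\<in>space \<gamma>. norm (orth_proj (V \<times> UNIV) (z - z\<^sub>0)) \<le> (1/2) ^ j})
      \<le> C * (real I + 1) * M)"
    using expected_weight_near[OF \<gamma>] by (rule exE)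
  note C0 = conjunct1[OF C] and C1 = conjunct2[OF C, rule_format, OF A]
  define q where "q = 2 powr (\<tau> - s)"
  have q: "0 \<le> q" "q < 1" using s(1) by (auto simp: q_def powr_less_one)
  define K where "K = C / \<kappa> * (\<Sum>j. (real j + (real c\<^sub>0 + 2)) * q ^ j)"
  have integral: "(\<integral>\<^sup>+V. ennreal (truncated_energy \<tau> (orth_proj (V \<times> UNIV)) n (S n) (p n)) \<partial>\<gamma>) \<le> ennreal K" for n
  proof -
    have near: "(\<Sum>y\<in>S n. p n y * prob {V\<in>space \<gamma>. norm (orth_proj (V \<times> UNIV) (y - x)) \<le> (1/2) ^ j})
        \<le> C * (real (j + c\<^sub>0 + 1) + 1) * (w ^ j / \<kappa>)" if x: "x \<in> S n" and j: "j \<le> n" for x j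
    proof -
      \<comment> \<open>The piece has diameter at most \<open>2 ^ (c\<^sub>0 + 1)\<close>; measured
        in units of 2^-j this gives the exponent \<open>j + c\<^sub>0 + 1\<close>.\<close>
      have "norm (y - x) \<le> 2 ^ (j + c\<^sub>0 + 1) * (1/2) ^ j" if "y \<in> S n" for y
      proof -
        have "norm x \<le> 2 ^ c\<^sub>0" "norm y \<le> 2 ^ c\<^sub>0"
          using that x S(2)[of n] by (auto simp: X_def)
        then have "norm (y - x) \<le> 2 ^ c\<^sub>0 + 2 ^ c\<^sub>0" using norm_triangle_ineq4[of y x] by linarith
        also have "\<dots> = 2 ^ (j + c\<^sub>0 + 1) * (1/2) ^ j" by (simp add: power_add power_one_over)
        finally show ?thesis .
      qed
      then show ?thesis
        by (intro C1 S(1) S(3) S(5)[OF j, unfolded D_def])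
    qed
    have "(\<Sum>j\<le>n. 2 powr (\<tau> * real j) * (\<Sum>x\<in>S n. p n x * (\<Sum>y\<in>S n. p n y *
        prob {V\<in>space \<gamma>. norm (orth_proj (V \<times> UNIV) (y - x)) \<le> (1/2) ^ j})))
      \<le> (\<Sum>j\<le>n. 2 powr (\<tau> * real j) * (\<Sum>x\<in>S n. p n x * (C * (real (j + c\<^sub>0 + 1) + 1) * (w ^ j / \<kappa>))))"
      by (intro sum_mono mult_left_mono near S(3)) auto
    also have "\<dots> = (\<Sum>j\<le>n. C / \<kappa> * ((real j + (real c\<^sub>0 + 2)) * q ^ j))"
    proof (intro sum.cong refl)
      fix j
      have "2 powr (\<tau> * real j) * w ^ j = q ^ j"
        by (simp add: w_def q_def powr_realpow[symmetric] powr_powr powr_add[symmetric] algebra_simps)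
      moreover have "(\<Sum>x\<in>S n. p n x * (C * (real (j + c\<^sub>0 + 1) + 1) * (w ^ j / \<kappa>)))
          = C * (real (j + c\<^sub>0 + 1) + 1) * (w ^ j / \<kappa>)"
        unfolding sum_distrib_right[symmetric] S(4) by simp
      ultimately show "2 powr (\<tau> * real j) * (\<Sum>x\<in>S n. p n x * (C * (real (j + c\<^sub>0 + 1) + 1) * (w ^ j / \<kappa>)))
          = C / \<kappa> * ((real j + (real c\<^sub>0 + 2)) * q ^ j)"
        by (simp add: mult_ac add_ac)
    qed
    also have "\<dots> \<le> K"
      unfolding K_def sum_distrib_left[symmetric]
    proof (intro mult_left_mono sum_le_suminf summable_linear_times_geometric)
      show "0 \<le> C / \<kappa>" using C0 \<kappa>(1) by simp
    qed (use q in auto)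
    finally show ?thesis
      by (subst nn_integral_truncated_energy(1)[OF \<gamma> S(1,3)]) (assumption, rule ennreal_leI)
  qed
  have "AE V in \<gamma>. \<exists>L::real. \<exists>\<^sub>F n in sequentially.
      ennreal (truncated_energy \<tau> (orth_proj (V \<times> UNIV)) n (S n) (p n)) \<le> ennreal L"
    by (rule AE_liminf_finite[OF _ integral]) (rule nn_integral_truncated_energy(2)[OF \<gamma> S(1,3)])
  moreover have "AE V in \<gamma>. V \<in> space \<gamma>" by (rule AE_space)
  ultimately show ?thesis
  proof eventually_elim
    case (elim V)
    then obtain L :: real where L: "\<exists>\<^sub>F n in sequentially.
      ennreal (truncated_energy \<tau> (orth_proj (V \<times> UNIV)) n (S n) (p n)) \<le> ennreal L" by blast
    have V: "subspace (V \<times> (UNIV :: 'b set))"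
      using elim \<gamma> by (simp add: space_grassmann subspace_Times)
    have cont: "continuous_on UNIV (orth_proj (V \<times> (UNIV :: 'b set)))"
      by (rule linear_continuous_on[OF linear_linear[THEN iffD2, OF linear_orth_proj[OF V]]])
    \<comment> \<open>\<open>ennreal L\<close> is 0 for negative \<open>L\<close>, hence the
      maximum.\<close>
    have energy: "\<exists>\<^sub>F n in sequentially.
        truncated_energy \<tau> (orth_proj (V \<times> UNIV)) n (S n) (p n) \<le> max 0 L"
      using L
    proof (rule frequently_elim1)
      fix n assume "ennreal (truncated_energy \<tau> (orth_proj (V \<times> UNIV)) n (S n) (p n)) \<le> ennreal L"
      then show "truncated_energy \<tau> (orth_proj (V \<times> UNIV)) n (S n) (p n) \<le> max 0 L"
        by (cases "0 \<le> L") (auto simp: ennreal_le_iff ennreal_neg)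
    qed
    have "S n \<subseteq> f ` {x. \<forall>i<n. x i \<le> \<nu> i}" for n using S(2)[of n] by (auto simp: X_def)
    from hausdorff_dim_ge_of_bounded_energy[OF \<tau>(1) f(1) cont S(1) this S(3,4) energy]
    have "ennreal \<tau> \<le> hausdorff_dim (orth_proj (V \<times> UNIV) ` range f)" .
    then show ?case by (simp add: proj_image_def f(2))
  qed
qed

theorem theorem1p3:
  fixes l m n :: nat
    and B :: "((real ^ 'p) \<times> (real ^ 'l)) set"
    and \<gamma> :: "(real ^ 'p) set measure"
  assumes "0 < l" "l < m" "m < n"
    and "CARD('p) = n - l" "CARD('l) = l"
    and "analytic_set B"
    and "is_grassmann_measure (m - l) \<gamma>"
  shows "AE V in \<gamma>. hausdorff_dim (proj_image B V) =
    (SUP W \<in> grassmannian (m - l). hausdorff_dim (proj_image B W))"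
proof -
  define M where "M = (SUP W \<in> grassmannian (m - l). hausdorff_dim (proj_image B W))"
  \<comment> \<open>Each exponent below the supremum is exceeded at a single \<open>W\<close>, which
    yields one null set; rational exponents keep the null sets countable in number.\<close>
  have "AE V in \<gamma>. 0 < r \<longrightarrow> ennreal (real_of_rat r) < M \<longrightarrow>
      ennreal (real_of_rat r) \<le> hausdorff_dim (proj_image B V)" for r
  proof (cases "0 < r \<and> ennreal (real_of_rat r) < M")
    case True
    then obtain W where "W \<in> grassmannian (m - l)" "ennreal (real_of_rat r) < hausdorff_dim (proj_image B W)"
      by (auto simp: M_def less_SUP_iff)
    then show ?thesis
      using AE_hausdorff_dim_proj_image_ge[OF assms(7,6), of W "real_of_rat r"] True by auto
  qed auto
  then have "AE V in \<gamma>. \<forall>r. 0 < r \<longrightarrow> ennreal (real_of_rat r) < M \<longrightarrow>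
      ennreal (real_of_rat r) \<le> hausdorff_dim (proj_image B V)"
    by (simp add: AE_all_countable)
  moreover have "AE V in \<gamma>. V \<in> space \<gamma>" by (rule AE_space)
  ultimately show ?thesis
  proof eventually_elim
    case (elim V)
    have "V \<in> grassmannian (m - l)" using elim assms(7) by (simp add: is_grassmann_measure_def)
    then have "hausdorff_dim (proj_image B V) \<le> M" unfolding M_def by (rule SUP_upper)
    moreover have "M \<le> hausdorff_dim (proj_image B V)"
    proof (rule ccontr)
      assume "\<not> M \<le> hausdorff_dim (proj_image B V)"
      then have "hausdorff_dim (proj_image B V) < M" by simp
      from ennreal_rat_dense[OF this] obtain r where r: "hausdorff_dim (proj_image B V) < ennreal (real_of_rat r)" "ennreal (real_of_rat r) < M"
        by blast
      then have "0 < ennreal (real_of_rat r)" using le_less_trans[OF zero_le] by blast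
      then have "0 < r" by simp
      with elim r show False by (auto simp: not_le[symmetric])
    qed
    ultimately show ?case unfolding M_def by (rule antisym)
  qed
qed

end
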